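(* Let $\mathcal{G}=(S,(S_E,S_A),A,\mathcal{P})$ be a stochastic game with finite state set $S$, equipped with a parity objective $\mathrm{Par}\subseteq S^\omega$ given by a priority function $\chi:S\to\mathbb{N}$. Let $\bar{\mathcal{G}}=(S,(S_E,S_A),A,\mathrm{BM})$ be the induced two-player BM game, where $(s,a,s')\in \mathrm{BM}$ if and only if $\mathcal{P}(s,a)(s')>0$, with the same parity objective. Then for every state $s\in S$: Eve wins almost-surely from $s$ in the stochastic game $\mathcal{G}$ if and only if Eve (and Banach) win strategically from $s$ in the two-player BM game $\bar{\mathcal{G}}$.
   Context: **Stochastic game.** A tuple $\mathcal{G}=(S,(S_E,S_A),A,\mathcal{P})$: $S$ is a finite set of states, partitioned into $S_E$ (Eve's states) and $S_A$ (Adam's states); $A$ is a finite nonempty set of actions; $\mathcal{P}:S\times A\to \mathrm{Distr}(S)$ is a total function to probability distributions on $S$. **Strategies of Eve and Adam.** A strategy for Eve is a function $\sigma:(SA)^*S_E\to A$; a strategy for Adam is a function $\tau:(SA)^*S_A\to A$. In a stochastic game, a pair $(\sigma,\tau)$ and an initial state $s$ induce the usual probability measure $\mathbb{P}_s^{\sigma,\tau}$ on the Borel sets of $S^\omega$ (sequences of states): the play starts at $s$; after a history $s_0a_0\cdots s_n$ the action $a_n$ is given by $\sigma$ if $s_n\in S_E$ and by $\tau$ if $s_n\in S_A$, and the next state is drawn from $\mathcal{P}(s_n,a_n)$. **Parity objective.** For $\chi:S\to\mathbb{N}$, $\mathrm{Par}=\{s_0s_1s_2\cdots\in S^\omega \mid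 \limsup_n \chi(s_n)\text{ is even}\}$. **Almost-sure winning.** Eve wins almost-surely from $s$ if there is a strategy $\sigma$ of Eve such that $\mathbb{P}_s^{\sigma,\tau}(\mathrm{Par})=1$ for every strategy $\tau$ of Adam. **Two-player BM game.** A tuple $(S,(S_E,S_A),A,\mathrm{BM})$, where $S$ is a finite set of states, partitioned into $S_E$ (Eve's states) and $S_A$ (Adam's states), $A$ is a finite nonempty set of actions, and $\mathrm{BM}\subseteq S\times A\times S$ is such that for all $s\in S$, $a\in A$ there is some $s'$ with $(s,a,s')\in \mathrm{BM}$. A strategy for Eve in a two-player BM game is a function $\sigma:(SA)^*S_E\to A$, and a strategy for Adam is a function $\tau:(SA)^*S_A\to A$. **Residual tree.** For strategies $\sigma,\tau$ and initial state $s$, let $\mathcal{G}_f(\sigma,\tau)\subseteq S(AS)^*$ be the smallest set containing $s$ and such that, if $wt\in \mathcal{G}_f(\sigma,\tau)$ with $t\in S$ its last letter, and $a=\sigma(wt)$ if $t\in S_E$, $a=\tau(wt)$ if $t\in S_A$, then $wtat'\in\mathcal{G}_f(\sigma,\tau)$ for all $t'$ with $(t,a,t')\in\mathrm{BM}$. The residual tree $\mathcal{G}(\sigma,\tau)$ is the set of infinite words all of whose prefixes in $S(AS)^*$ belong to $\mathcal{G}_f(\sigma,\tau)$. **Banach-Mazur game.** For a set $X$ of infinite words and an objective $\Phi$, the Banach-Mazur game on $X$ is played by Banach and Mazur: Mazur plays a finite prefix $w_0$ of some word of $X$; Banach extends it to a strictly longer finite prefix $w_1$ of some word of $X$; Mazur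 extends $w_1$ strictly to $w_2$, and so on alternately. Banach wins the play if the limit infinite word belongs to the objective; otherwise Mazur wins. "Banach (Mazur) wins the game" means that he has a winning strategy. On a residual tree with objective $\Phi\subseteq S^\omega$, an infinite word is in the objective when its projection to $S^\omega$ (erasing the actions) is in $\Phi$. **Strategic winning.** Eve and Banach win strategically from $s$ (also: Eve wins from $s$) if there is a strategy $\sigma$ of Eve such that for every strategy $\tau$ of Adam, Banach wins the Banach-Mazur game on the residual tree $\mathcal{G}(\sigma,\tau)$ from $s$. *)

theory Defs
  imports "HOL-Probability.Probability" "HOL-Library.Extended_Nat" "HOL-Library.Sublist"
begin

section \<open>Games\<close>

text \<open>The finite set of states and the finite nonempty set of actions are types of class
  \<open>finite\<close>; probability distributions on states are therefore elements of \<open>pmf\<close>.\<close>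

record 's arena =
  Eve :: "'s set"
  Adam :: "'s set"

record ('s, 'a) stochastic_game = "'s arena" +
  trans :: "'s \<Rightarrow> 'a \<Rightarrow> 's pmf"

record ('s, 'a) bm_game = "'s arena" +
  BM :: "('s \<times> 'a \<times> 's) set"

definition is_arena :: "('s, 'z) arena_scheme \<Rightarrow> bool" where
  "is_arena G \<longleftrightarrow> Eve G \<union> Adam G = UNIV \<and> Eve G \<inter> Adam G = {}"

definition is_stochastic_game :: "('s::finite, 'a::finite) stochastic_game \<Rightarrow> bool" where
  "is_stochastic_game G \<longleftrightarrow> is_arena G"

definition is_bm_game :: "('s::finite, 'a::finite) bm_game \<Rightarrow> bool" where
  "is_bm_game G \<longleftrightarrow> is_arena G \<and> (\<forall>s a. \<exists>s'. (s, a, s') \<in> BM G)"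

definition induced_bm_game :: "('s, 'a) stochastic_game \<Rightarrow> ('s, 'a) bm_game" where
  "induced_bm_game G =
     \<lparr>Eve = Eve G, Adam = Adam G, BM = {(s, a, s'). pmf (trans G s a) s' > 0}\<rparr>"

lemma is_bm_game_induced:
  fixes G :: "('s::finite, 'a::finite) stochastic_game"
  assumes "is_stochastic_game G"
  shows "is_bm_game (induced_bm_game G)"
  using assms
  by (auto simp: is_bm_game_def is_stochastic_game_def is_arena_def induced_bm_game_def
      pmf_positive_iff intro: set_pmf_not_empty[THEN ex_in_conv[THEN iffD2]])


section \<open>Histories and strategies\<close>

text \<open>Finite and infinite words over the letters below. A strategy is consulted only on histories
  \<open>s\<^sub>0 a\<^sub>0 \<dots> s\<^sub>n\<close> whose last state belongs to the respective player; its values on other words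
  are irrelevant.\<close>

datatype ('s, 'a) letter = State (the_state: 's) | Action (the_action: 'a)

type_synonym ('s, 'a) strategy = "('s, 'a) letter list \<Rightarrow> 'a"

definition choice ::
  "('s, 'z) arena_scheme \<Rightarrow> ('s, 'a) strategy \<Rightarrow> ('s, 'a) strategy \<Rightarrow> ('s, 'a) letter list \<Rightarrow> 's \<Rightarrow> 'a"
where
  "choice G \<sigma> \<tau> h t = (if t \<in> Eve G then \<sigma> h else \<tau> h)"


section \<open>Stochastic games\<close>

text \<open>As strategies are deterministic, the sequence of visited states determines the actions.\<close>

primrec hist ::
  "('s, 'z) arena_scheme \<Rightarrow> ('s, 'a) strategy \<Rightarrow> ('s, 'a) strategy \<Rightarrow> (nat \<Rightarrow> 's) \<Rightarrow> nat
    \<Rightarrow> ('s, 'a) letter list"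
where
  "hist G \<sigma> \<tau> \<omega> 0 = [State (\<omega> 0)]"
| "hist G \<sigma> \<tau> \<omega> (Suc n) =
     hist G \<sigma> \<tau> \<omega> n @ [Action (choice G \<sigma> \<tau> (hist G \<sigma> \<tau> \<omega> n) (\<omega> n)), State (\<omega> (Suc n))]"

text \<open>The distribution of the \<open>n\<close>-th state given the states \<open>\<omega> 0, \<dots>, \<omega> (n - 1)\<close>.\<close>

definition next_state ::
  "('s, 'a) stochastic_game \<Rightarrow> ('s, 'a) strategy \<Rightarrow> ('s, 'a) strategy \<Rightarrow> 's \<Rightarrow> nat \<Rightarrow> (nat \<Rightarrow> 's)
    \<Rightarrow> 's pmf"
where
  "next_state G \<sigma> \<tau> s n \<omega> =
     (case n of
        0 \<Rightarrow> return_pmf s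
      | Suc m \<Rightarrow> trans G (\<omega> m) (choice G \<sigma> \<tau> (hist G \<sigma> \<tau> \<omega> m) (\<omega> m)))"

lemma Ionescu_Tulcea_next_state:
  fixes G :: "('s::finite, 'a) stochastic_game"
  shows "Ionescu_Tulcea (\<lambda>n \<omega>. measure_pmf (next_state G \<sigma> \<tau> s n \<omega>)) (\<lambda>_. count_space UNIV)"
proof
  fix n :: nat
  let ?M = "PiM {0..<n} (\<lambda>_. count_space (UNIV :: 's set))"
  have fin: "finite (space ?M)"
    by (auto simp: space_PiM intro!: finite_PiE)
  have sing: "{x} \<in> sets ?M" if "x \<in> space ?M" for x
  proof -
    have "{x} = (\<Pi>\<^sub>E i\<in>{0..<n}. {x i})"
      using that by (simp add: space_PiM PiE_iff PiE_singleton)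
    then show ?thesis by (auto intro!: sets_PiM_I_finite)
  qed
  have "A \<in> sets ?M" if A: "A \<subseteq> space ?M" for A
  proof -
    have "(\<Union>x\<in>A. {x}) \<in> sets ?M"
      using A fin sing by (intro sets.finite_UN) (auto intro: finite_subset)
    then show ?thesis by simp
  qed
  then have sets: "A \<in> sets ?M \<longleftrightarrow> A \<subseteq> space ?M" for A
    using sets.sets_into_space by blast
  show "(\<lambda>\<omega>. measure_pmf (next_state G \<sigma> \<tau> s n \<omega>)) \<in> ?M \<rightarrow>\<^sub>M subprob_algebra (count_space UNIV)"
    by (rule measurableI) (auto simp: sets measure_pmf_in_subprob_algebra)
qed

text \<open>The measure on \<open>S\<^sup>\<omega>\<close>, given by the Ionescu-Tulcea theorem.\<close>

definition play_measure ::
  "('s, 'a) stochastic_game \<Rightarrow> ('s, 'a) strategy \<Rightarrow> ('s, 'a) strategy \<Rightarrow> 's \<Rightarrow> (nat \<Rightarrow> 's) measure"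
where
  "play_measure G \<sigma> \<tau> s =
     projective_family.lim UNIV
       (Ionescu_Tulcea.CI (\<lambda>n \<omega>. measure_pmf (next_state G \<sigma> \<tau> s n \<omega>)) (\<lambda>_. count_space UNIV))
       (\<lambda>_. count_space UNIV)"

lemma sets_play_measure:
  fixes G :: "('s::finite, 'a) stochastic_game"
  shows "sets (play_measure G \<sigma> \<tau> s) = sets (PiM UNIV (\<lambda>_. count_space UNIV))"
proof -
  interpret Ionescu_Tulcea "\<lambda>n \<omega>. measure_pmf (next_state G \<sigma> \<tau> s n \<omega>)" "\<lambda>_. count_space UNIV"
    by (rule Ionescu_Tulcea_next_state)
  show ?thesis
    unfolding play_measure_def by simp
qed

lemma prob_space_play_measure:
  fixes G :: "('s::finite, 'a) stochastic_game"
  shows "prob_space (play_measure G \<sigma> \<tau> s)"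
proof -
  interpret Ionescu_Tulcea "\<lambda>n \<omega>. measure_pmf (next_state G \<sigma> \<tau> s n \<omega>)" "\<lambda>_. count_space UNIV"
    by (rule Ionescu_Tulcea_next_state)
  have "prob_space (CI {})"
    by (rule PF.prob_space_P) auto
  then have "emeasure (CI {}) (space (PiM {} (\<lambda>_. count_space UNIV))) = 1"
    by (metis PF.space_P finite.emptyI subset_UNIV prob_space.emeasure_space_1)
  then have "emeasure PF.lim (PF.emb UNIV {} (space (PiM {} (\<lambda>_. count_space UNIV)))) = 1"
    by (subst lim) auto
  then show ?thesis
    unfolding play_measure_def
    by (intro prob_spaceI) (simp add: prod_emb_def space_PiM PF.space_lim vimage_def restrict_def)
qed

definition parity_objective :: "('s \<Rightarrow> nat) \<Rightarrow> (nat \<Rightarrow> 's) set" where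
  "parity_objective prio = {\<omega>. \<exists>k. even k \<and> limsup (\<lambda>n. enat (prio (\<omega> n))) = enat k}"

lemma parity_objective_measurable:
  fixes G :: "('s::finite, 'a) stochastic_game"
  shows "parity_objective prio \<in> sets (play_measure G \<sigma> \<tau> s)"
proof -
  let ?M = "PiM UNIV (\<lambda>_. count_space UNIV) :: (nat \<Rightarrow> 's) measure"
  have "(\<lambda>\<omega>. enat (prio (\<omega> n))) \<in> borel_measurable ?M" for n
    by (rule measurable_compose[OF measurable_component_singleton]) auto
  then have [measurable]: "(\<lambda>\<omega>. limsup (\<lambda>n. enat (prio (\<omega> n)))) \<in> borel_measurable ?M"
    by (rule borel_measurable_limsup)
  have "{\<omega>\<in>space ?M. \<exists>k. even k \<and> limsup (\<lambda>n. enat (prio (\<omega> n))) = enat k} \<in> sets ?M"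
    by measurable
  then show ?thesis
    by (simp add: parity_objective_def sets_play_measure space_PiM)
qed

definition wins_almost_surely ::
  "('s, 'a) stochastic_game \<Rightarrow> (nat \<Rightarrow> 's) set \<Rightarrow> 's \<Rightarrow> bool"
where
  "wins_almost_surely G \<Phi> s \<longleftrightarrow> (\<exists>\<sigma>. \<forall>\<tau>. measure (play_measure G \<sigma> \<tau> s) \<Phi> = 1)"


section \<open>Banach-Mazur games\<close>

text \<open>Infinite words over the alphabet \<open>'l\<close> are functions \<open>nat \<Rightarrow> 'l\<close>.\<close>

definition pref :: "(nat \<Rightarrow> 'l) \<Rightarrow> nat \<Rightarrow> 'l list" where
  "pref x n = map x [0..<n]"

definition finite_prefixes :: "(nat \<Rightarrow> 'l) set \<Rightarrow> 'l list set" where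
  "finite_prefixes X = {pref x n | x n. x \<in> X}"

text \<open>A nonempty list \<open>[w\<^sub>0, \<dots>, w\<^sub>n]\<close> of successive moves; Mazur makes the moves with
  even index, Banach those with odd index.\<close>

definition bm_position :: "(nat \<Rightarrow> 'l) set \<Rightarrow> 'l list list \<Rightarrow> bool" where
  "bm_position X ws \<longleftrightarrow>
     ws \<noteq> [] \<and> set ws \<subseteq> finite_prefixes X \<and> (\<forall>i. Suc i < length ws \<longrightarrow> strict_prefix (ws ! i) (ws ! Suc i))"

definition banach_strategy :: "(nat \<Rightarrow> 'l) set \<Rightarrow> ('l list list \<Rightarrow> 'l list) \<Rightarrow> bool" where
  "banach_strategy X \<beta> \<longleftrightarrow>
     (\<forall>ws. bm_position X ws \<and> odd (length ws) \<longrightarrow> bm_position X (ws @ [\<beta> ws]))"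

definition bm_play :: "(nat \<Rightarrow> 'l) set \<Rightarrow> (nat \<Rightarrow> 'l list) \<Rightarrow> bool" where
  "bm_play X w \<longleftrightarrow> (\<forall>n. w n \<in> finite_prefixes X \<and> strict_prefix (w n) (w (Suc n)))"

text \<open>In a play, \<open>w (Suc i)\<close> has length greater than \<open>i\<close>, and hence has an \<open>i\<close>-th letter.\<close>

definition bm_limit :: "(nat \<Rightarrow> 'l list) \<Rightarrow> nat \<Rightarrow> 'l" where
  "bm_limit w i = w (Suc i) ! i"

definition banach_wins :: "(nat \<Rightarrow> 'l) set \<Rightarrow> (nat \<Rightarrow> 'l) set \<Rightarrow> bool" where
  "banach_wins X \<Psi> \<longleftrightarrow>
     (\<exists>\<beta>. banach_strategy X \<beta> \<and>
        (\<forall>w. bm_play X w \<and> (\<forall>n. odd n \<longrightarrow> w n = \<beta> (pref w n)) \<longrightarrow> bm_limit w \<in> \<Psi>))"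

lemma bm_limit_unique:
  assumes "bm_play X w"
  shows "(\<forall>n. w n = pref x (length (w n))) \<longleftrightarrow> x = bm_limit w"
proof -
  have len: "n \<le> length (w n)" for n
  proof (induction n)
    case (Suc n)
    with assms show ?case
      unfolding bm_play_def by (meson Suc_leI le_less_trans prefix_length_less)
  qed simp
  have mono: "prefix (w n) (w m)" if "n \<le> m" for n m
    using that
  proof (induction rule: dec_induct)
    case (step m)
    with assms show ?case
      unfolding bm_play_def by (meson prefix_order.less_imp_le prefix_order.trans)
  qed simp
  have nth: "w n ! i = bm_limit w i" if "i < length (w n)" for n i
  proof -
    have "i < length (w (Suc i))"
      using len[of "Suc i"] by simp
    then show ?thesis
      using mono[of n "Suc i"] mono[of "Suc i" n] that
      unfolding bm_limit_def prefix_def by (metis nat_le_linear nth_append)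
  qed
  show ?thesis
  proof
    assume *: "\<forall>n. w n = pref x (length (w n))"
    show "x = bm_limit w"
    proof
      fix i
      have i: "i < length (w (Suc i))"
        using len[of "Suc i"] by simp
      have "w (Suc i) ! i = pref x (length (w (Suc i))) ! i"
        using * by metis
      with i show "x i = bm_limit w i"
        by (simp add: bm_limit_def pref_def)
    qed
  qed (auto simp: pref_def nth intro!: nth_equalityI)
qed


section \<open>Strategic winning in two-player BM games\<close>

inductive_set residual_prefixes ::
  "('s, 'a) bm_game \<Rightarrow> ('s, 'a) strategy \<Rightarrow> ('s, 'a) strategy \<Rightarrow> 's \<Rightarrow> ('s, 'a) letter list set"
  for G \<sigma> \<tau> s
where
  root: "[State s] \<in> residual_prefixes G \<sigma> \<tau> s"
| step: "w @ [State t] \<in> residual_prefixes G \<sigma> \<tau> s \<Longrightarrow> a = choice G \<sigma> \<tau> (w @ [State t]) t \<Longrightarrow>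
    (t, a, t') \<in> BM G \<Longrightarrow> w @ [State t, Action a, State t'] \<in> residual_prefixes G \<sigma> \<tau> s"

text \<open>The prefixes in \<open>S(AS)\<^sup>*\<close> of a word in \<open>S(AS)\<^sup>\<omega>\<close> are those of odd length.\<close>

definition residual_tree ::
  "('s, 'a) bm_game \<Rightarrow> ('s, 'a) strategy \<Rightarrow> ('s, 'a) strategy \<Rightarrow> 's \<Rightarrow> (nat \<Rightarrow> ('s, 'a) letter) set"
where
  "residual_tree G \<sigma> \<tau> s = {x. \<forall>n. pref x (2 * n + 1) \<in> residual_prefixes G \<sigma> \<tau> s}"

text \<open>Erasing the actions from a word in \<open>S(AS)\<^sup>\<omega>\<close>: the states are the letters at the even
  positions.\<close>

definition state_seq :: "(nat \<Rightarrow> ('s, 'a) letter) \<Rightarrow> nat \<Rightarrow> 's" where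
  "state_seq x n = the_state (x (2 * n))"

lemma residual_prefixes_alternate:
  assumes "u \<in> residual_prefixes G \<sigma> \<tau> s"
  shows "odd (length u) \<and> (\<forall>i<length u. is_State (u ! i) \<longleftrightarrow> even i)"
  using assms
proof induction
  case (step w t a t')
  then show ?case
    by (auto simp: nth_append nth_Cons' less_Suc_eq)
qed auto

lemma residual_tree_alternates:
  assumes "x \<in> residual_tree G \<sigma> \<tau> s"
  shows "is_State (x i) \<longleftrightarrow> even i"
proof -
  have "pref x (2 * i + 1) \<in> residual_prefixes G \<sigma> \<tau> s"
    using assms by (simp add: residual_tree_def)
  from residual_prefixes_alternate[OF this] show ?thesis
    by (auto simp: pref_def simp del: upt_Suc dest: spec[of _ i])
qed

definition wins_strategically ::
  "('s, 'a) bm_game \<Rightarrow> (nat \<Rightarrow> 's) set \<Rightarrow> 's \<Rightarrow> bool"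
where
  "wins_strategically G \<Phi> s \<longleftrightarrow>
     (\<exists>\<sigma>. \<forall>\<tau>. banach_wins (residual_tree G \<sigma> \<tau> s) {x. state_seq x \<in> \<Phi>})"

end

theory Submission
  imports Defs
begin

text \<open>Call a play fair if, whenever a state-action pair occurs infinitely often, each of its possible
  transitions is taken infinitely often. Fairness is the only thing the two semantics share, and it
  suffices. Almost every play is fair, every cone has positive measure, and in the Banach-Mazur game
  either player can force the limit to be fair. Hence, for fixed \<open>\<sigma>\<close> and \<open>\<tau>\<close>, Eve wins in
  both senses if all fair plays satisfy the objective, and in neither sense if some finite play has
  no fair extension satisfying it.

  It remains to show a finite determinacy result: either Eve has a strategy of the first kind
  (against every \<open>\<tau>\<close>), or Adam has one that enforces the second alternative (against every
  \<open>\<sigma>\<close>). The states visited infinitely often by a fair play form an end component, so both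
  alternatives can be certified by positional strategies on a finite graph with Eve, Adam and random
  vertices. Certificates are built by Zielonka's recursion, on arenas closed under randomness. If the
  maximal priority \<open>d\<close> is even, solve the complement of Eve's attractor of \<open>d\<close>: if Adam loses
  everywhere there, Eve wins everywhere; otherwise remove Adam's attractor of his region and recurse.
  If \<open>d\<close> is odd, solve the complement of Adam's attractor of \<open>d\<close>: if Eve loses everywhere there,
  she loses everywhere; otherwise proceed as before, with Eve's region in the role of \<open>d\<close>.\<close>


section \<open>Determinacy of finite fair parity games\<close>

locale fair_parity_game =
  fixes E :: "('v::finite) rel" and VE VN :: "'v set" and prio :: "'v \<Rightarrow> nat"
  assumes disjoint: "VE \<inter> VN = {}"
begin

section \<open>Certificates of winning on a finite graph\<close>

definition arena :: "'v set \<Rightarrow> bool" where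
  "arena X \<longleftrightarrow> (\<forall>v\<in>X. \<exists>w\<in>X. (v, w) \<in> E) \<and> (\<forall>v\<in>X \<inter> VN. E `` {v} \<subseteq> X)"

definition consistent :: "'v set \<Rightarrow> ('v \<Rightarrow> 'v) \<Rightarrow> 'v rel" where
  "consistent P \<sigma> = {(v, w) \<in> E. v \<in> P \<longrightarrow> w = \<sigma> v}"

abbreviation VA :: "'v set" where
  "VA \<equiv> - (VE \<union> VN)"

text \<open>With \<open>\<^sup>+\<close> rather than \<open>\<^sup>*\<close>, a single vertex
  qualifies only if it carries a loop, so that every vertex of an end component has a successor
  inside it.\<close>

definition end_component :: "'v rel \<Rightarrow> 'v set \<Rightarrow> bool" where
  "end_component F C \<longleftrightarrow> C \<noteq> {} \<and> (\<forall>v\<in>C \<inter> VN. E `` {v} \<subseteq> C) \<and>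
     (\<forall>u\<in>C. \<forall>v\<in>C. (u, v) \<in> (F \<inter> C \<times> C)\<^sup>+)"

abbreviation even_max :: "'v set \<Rightarrow> bool" where
  "even_max C \<equiv> even (Max (prio ` C))"

text \<open>All edges of Adam remain in \<open>consistent VE \<sigma>\<close>. The last condition
  therefore covers opponents with memory too: whatever Adam does, the vertices that a fair play
  visits infinitely often form an end component of this graph.\<close>

definition eve_cert :: "'v set \<Rightarrow> 'v set \<Rightarrow> ('v \<Rightarrow> 'v) \<Rightarrow> bool" where
  "eve_cert X W \<sigma> \<longleftrightarrow> W \<subseteq> X \<and> (\<forall>v\<in>W \<inter> VE. (v, \<sigma> v) \<in> E \<and> \<sigma> v \<in> W) \<and>
     (\<forall>v\<in>W - VE. E `` {v} \<inter> X \<subseteq> W) \<and>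
     (\<forall>C\<subseteq>W. end_component (consistent VE \<sigma>) C \<longrightarrow> even_max C)"

text \<open>Counting random exits from \<open>L\<close> as successes for Eve is what lets losing regions of subarenas
  be glued: an exit from one layer may lead into another.\<close>

definition hopeful :: "'v rel \<Rightarrow> 'v set \<Rightarrow> 'v set \<Rightarrow> bool" where
  "hopeful F L R \<longleftrightarrow> (\<forall>v\<in>R \<inter> VN. E `` {v} \<inter> L \<subseteq> R) \<and>
     (\<forall>v\<in>R. \<exists>u. (v, u) \<in> (F \<inter> R \<times> R)\<^sup>* \<and>
        ((\<exists>C\<subseteq>R. end_component F C \<and> even_max C \<and> u \<in> C) \<or> (u \<in> R \<inter> VN \<and> \<not> E `` {u} \<subseteq> L)))"

text \<open>Eve may use memory, so the condition concerns sets \<open>R\<close> of vertices that she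
  can keep reachable rather than her positional strategies: in a hopeful set every vertex still has
  a path to an even end component or to a random exit. Adam's \<open>\<tau>\<close> must rule out
  all nonempty sets of this kind.\<close>

definition adam_cert :: "'v set \<Rightarrow> 'v set \<Rightarrow> ('v \<Rightarrow> 'v) \<Rightarrow> bool" where
  "adam_cert X L \<tau> \<longleftrightarrow> L \<subseteq> X \<and> (\<forall>v\<in>L \<inter> VE. E `` {v} \<inter> X \<subseteq> L) \<and>
     (\<forall>v\<in>L \<inter> VA. (v, \<tau> v) \<in> E \<and> \<tau> v \<in> L) \<and>
     (\<forall>R\<subseteq>L. R \<noteq> {} \<longrightarrow> \<not> hopeful (consistent VA \<tau>) L R)"

lemma eve_certD:
  assumes "eve_cert X W \<sigma>" "end_component (consistent VE \<sigma>) C" "C \<subseteq> W"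
  shows "even_max C"
  using assms by (simp add: eve_cert_def)

lemma adam_certD:
  assumes "adam_cert X L \<tau>" "hopeful (consistent VA \<tau>) L R" "R \<subseteq> L"
  shows "R = {}"
proof -
  have "\<forall>R\<subseteq>L. R \<noteq> {} \<longrightarrow> \<not> hopeful (consistent VA \<tau>) L R"
    using assms(1) by (simp add: adam_cert_def)
  then show ?thesis using assms(2,3) by metis
qed

lemma end_component_succ:
  assumes "end_component F C" "v \<in> C"
  obtains w where "w \<in> C" "(v, w) \<in> F"
proof -
  have "(v, v) \<in> (F \<inter> C \<times> C)\<^sup>+"
    using assms by (auto simp: end_component_def)
  then show thesis
    by (rule converse_tranclE) (auto intro: that)
qed

lemma end_component_mono:
  assumes "end_component F C" "F \<inter> C \<times> C \<subseteq> F'"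
  shows "end_component F' C"
proof -
  have "F \<inter> C \<times> C \<subseteq> F' \<inter> C \<times> C" using assms(2) by auto
  from trancl_mono[OF _ this] show ?thesis
    using assms(1) by (auto simp: end_component_def)
qed

text \<open>Strong connectivity: a path inside \<open>C\<close> from the common vertex reaches any
  other vertex and never leaves \<open>W\<close>.\<close>

lemma end_component_subset:
  assumes C: "end_component F C" and "C \<inter> W \<noteq> {}"
    and closed: "\<And>v w. v \<in> C \<Longrightarrow> v \<in> W \<Longrightarrow> w \<in> C \<Longrightarrow> (v, w) \<in> F \<Longrightarrow> w \<in> W"
  shows "C \<subseteq> W"
proof
  fix v assume "v \<in> C"
  obtain u where u: "u \<in> C" "u \<in> W" using assms(2) by auto
  then have "(u, v) \<in> (F \<inter> C \<times> C)\<^sup>+"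
    using C \<open>v \<in> C\<close> by (auto simp: end_component_def)
  then show "v \<in> W"
    by induction (use u closed in auto)
qed

text \<open>Exits are random vertices. Hence, if the path promised for \<open>v\<close> is empty,
  \<open>v\<close> lies in an end component, which supplies the successor.\<close>

lemma hopeful_succ:
  assumes "hopeful F L R" "v \<in> R" "v \<notin> VN"
  obtains w where "w \<in> R" "(v, w) \<in> F"
proof -
  obtain u where u: "(v, u) \<in> (F \<inter> R \<times> R)\<^sup>*"
    "(\<exists>C\<subseteq>R. end_component F C \<and> even_max C \<and> u \<in> C) \<or> (u \<in> R \<inter> VN \<and> \<not> E `` {u} \<subseteq> L)"
    using assms(1,2) unfolding hopeful_def by meson
  from u(1) show thesis
  proof (cases rule: converse_rtranclE)
    case base
    then obtain C where C: "C \<subseteq> R" "end_component F C" "v \<in> C"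
      using u(2) assms(3) by blast
    obtain w where "w \<in> C" "(v, w) \<in> F"
      by (rule end_component_succ[OF C(2,3)])
    then show thesis using C(1) that by blast
  next
    case (step y)
    then show thesis using that by auto
  qed
qed

section \<open>Attractors, ranks and rank-decreasing moves\<close>

primrec attr_stage :: "'v set \<Rightarrow> 'v set \<Rightarrow> 'v set \<Rightarrow> nat \<Rightarrow> 'v set" where
  "attr_stage P X T 0 = T"
| "attr_stage P X T (Suc n) = attr_stage P X T n \<union>
     {v\<in>X. if v \<in> P then E `` {v} \<inter> attr_stage P X T n \<noteq> {} else E `` {v} \<inter> X \<subseteq> attr_stage P X T n}"

text \<open>In all uses \<open>VN \<subseteq> P\<close>: random vertices help in the attractors of both players, so the
  complement of an attractor is again closed under randomness.\<close>

definition attr :: "'v set \<Rightarrow> 'v set \<Rightarrow> 'v set \<Rightarrow> 'v set" where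
  "attr P X T = (\<Union>n. attr_stage P X T n)"

lemma attr_stage_mono: "m \<le> n \<Longrightarrow> attr_stage P X T m \<subseteq> attr_stage P X T n"
  by (rule lift_Suc_mono_le) auto

lemma attr_base: "T \<subseteq> attr P X T"
  unfolding attr_def using attr_stage.simps(1) by blast

lemma attr_subset: "T \<subseteq> X \<Longrightarrow> attr P X T \<subseteq> X"
proof -
  assume "T \<subseteq> X"
  then have "attr_stage P X T n \<subseteq> X" for n
    by (induction n) auto
  then show ?thesis by (auto simp: attr_def)
qed

lemma attr_helper:
  assumes "v \<in> X - attr P X T" "v \<in> P"
  shows "E `` {v} \<inter> attr P X T = {}"
proof (rule ccontr)
  assume "\<not> ?thesis"
  then obtain n where "E `` {v} \<inter> attr_stage P X T n \<noteq> {}"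
    by (auto simp: attr_def)
  then have "v \<in> attr_stage P X T (Suc n)"
    using assms by simp
  then show False using assms by (auto simp: attr_def simp del: attr_stage.simps)
qed

text \<open>There are finitely many successors, so if all of them were attracted, they would be so
  by a common stage, and the next stage would contain \<open>v\<close>.\<close>

lemma attr_opponent:
  assumes "v \<in> X - attr P X T" "v \<notin> P"
  shows "\<not> E `` {v} \<inter> X \<subseteq> attr P X T"
proof
  assume *: "E `` {v} \<inter> X \<subseteq> attr P X T"
  let ?S = "E `` {v} \<inter> X"
  have "\<forall>w\<in>?S. \<exists>n. w \<in> attr_stage P X T n"
    using * by (auto simp: attr_def)
  then obtain n where n: "\<And>w. w \<in> ?S \<Longrightarrow> w \<in> attr_stage P X T (n w)"
    by metis
  have "w \<in> attr_stage P X T (Max (n ` ?S))" if "w \<in> ?S" for w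
    using n[OF that] attr_stage_mono[of "n w" "Max (n ` ?S)"] that by auto
  then obtain n where "?S \<subseteq> attr_stage P X T n" by blast
  then have "v \<in> attr_stage P X T (Suc n)"
    using assms by simp
  then show False using assms by (auto simp: attr_def simp del: attr_stage.simps)
qed

definition attr_rank :: "'v set \<Rightarrow> 'v set \<Rightarrow> 'v set \<Rightarrow> 'v \<Rightarrow> nat" where
  "attr_rank P X T v = (LEAST n. v \<in> attr_stage P X T n)"

definition attr_move :: "'v set \<Rightarrow> 'v set \<Rightarrow> 'v set \<Rightarrow> 'v \<Rightarrow> 'v" where
  "attr_move P X T v = (SOME w. (v, w) \<in> E \<and> w \<in> attr P X T \<and> attr_rank P X T w < attr_rank P X T v)"

text \<open>A vertex outside the target enters at a stage \<open>Suc n\<close> equal to its rank, so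
  the defining condition of that stage must hold for it; the vertices of stage \<open>n\<close> have
  smaller rank.\<close>

lemma attr_rank_less:
  assumes "v \<in> attr P X T - T"
  shows "(if v \<in> P then \<exists>w\<in>attr P X T. (v, w) \<in> E \<and> attr_rank P X T w < attr_rank P X T v
    else \<forall>w\<in>X. (v, w) \<in> E \<longrightarrow> w \<in> attr P X T \<and> attr_rank P X T w < attr_rank P X T v)"
proof -
  have in_stage: "v \<in> attr_stage P X T (attr_rank P X T v)"
    using assms unfolding attr_rank_def attr_def by (auto intro: LeastI)
  have le: "attr_rank P X T w \<le> n" if "w \<in> attr_stage P X T n" for w n
    using that unfolding attr_rank_def by (rule Least_le)
  obtain n where n: "attr_rank P X T v = Suc n"
    using in_stage assms by (cases "attr_rank P X T v") auto
  have "v \<notin> attr_stage P X T n"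
    using le[of v n] n by auto
  with in_stage n have "if v \<in> P then E `` {v} \<inter> attr_stage P X T n \<noteq> {}
    else E `` {v} \<inter> X \<subseteq> attr_stage P X T n"
    by auto
  moreover have "w \<in> attr P X T \<and> attr_rank P X T w < attr_rank P X T v"
    if "w \<in> attr_stage P X T n" for w
    using le[OF that] that n by (auto simp: attr_def)
  ultimately show ?thesis
    by (auto split: if_splits)
qed

lemma attr_move:
  assumes "v \<in> attr P X T - T" "v \<in> P"
  shows "(v, attr_move P X T v) \<in> E \<and> attr_move P X T v \<in> attr P X T \<and>
    attr_rank P X T (attr_move P X T v) < attr_rank P X T v"
  unfolding attr_move_def
  by (rule someI_ex) (use attr_rank_less[OF assms(1)] assms(2) in auto)

text \<open>Descent on the rank. It is applied to end components and to hopeful sets, neither of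
  which need contain all successors of their vertices.\<close>

lemma attr_hits:
  assumes "v \<in> C" "v \<in> attr P X T"
    and "\<And>v. v \<in> C \<Longrightarrow> v \<in> attr P X T - T \<Longrightarrow>
      \<exists>w\<in>C. w \<in> attr P X T \<and> attr_rank P X T w < attr_rank P X T v"
  shows "C \<inter> T \<noteq> {}"
  using assms(1,2)
proof (induction "attr_rank P X T v" arbitrary: v rule: less_induct)
  case less
  then show ?case
    using assms(3)[of v] by (cases "v \<in> T") blast+
qed

lemma arena_minus_attr:
  assumes "arena X" "VN \<subseteq> P" "T \<subseteq> X"
  shows "arena (X - attr P X T)"
  unfolding arena_def
proof (intro conjI ballI)
  fix v assume v: "v \<in> X - attr P X T"
  show "\<exists>w\<in>X - attr P X T. (v, w) \<in> E"
  proof (cases "v \<in> P")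
    case True
    from attr_helper[OF v True] show ?thesis
      using assms(1) v unfolding arena_def by blast
  next
    case False
    from attr_opponent[OF v False] show ?thesis by blast
  qed
next
  fix v assume v: "v \<in> (X - attr P X T) \<inter> VN"
  then show "E `` {v} \<subseteq> X - attr P X T"
    using attr_helper[of v X P T] assms(1,2) by (auto simp: arena_def)
qed

text \<open>An end component that misses the attractor is one for \<open>\<sigma>'\<close>, and
  \<open>rest\<close> applies. One that meets it must reach \<open>T\<close> by descent on the rank,
  and \<open>good\<close> applies.\<close>

lemma eve_cert_attr:
  assumes X: "arena X" and T: "T \<subseteq> X"
    and rest: "eve_cert (X - attr (VE \<union> VN) X T) (X - attr (VE \<union> VN) X T) \<sigma>'"
    and \<sigma>T: "\<And>v. v \<in> T \<inter> VE \<Longrightarrow> (v, \<sigma>T v) \<in> E \<and> \<sigma>T v \<in> X"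
    and good: "\<And>\<sigma> C. (\<And>v. v \<in> T \<inter> VE \<Longrightarrow> \<sigma> v = \<sigma>T v) \<Longrightarrow> C \<subseteq> X \<Longrightarrow>
       end_component (consistent VE \<sigma>) C \<Longrightarrow> C \<inter> T \<noteq> {} \<Longrightarrow> even_max C"
  shows "\<exists>\<sigma>. eve_cert X X \<sigma>"
proof -
  let ?P = "VE \<union> VN" 
  let ?Y = "attr ?P X T"
  define \<sigma> where "\<sigma> v = (if v \<in> T then \<sigma>T v else if v \<in> ?Y then attr_move ?P X T v else \<sigma>' v)" for v
  have YX: "?Y \<subseteq> X" by (rule attr_subset[OF T])
  have "eve_cert X X \<sigma>"
    unfolding eve_cert_def
  proof (intro conjI ballI allI impI)
    fix v assume v: "v \<in> X \<inter> VE"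
    have "(v, \<sigma> v) \<in> E \<and> \<sigma> v \<in> X"
    proof (cases "v \<in> ?Y - T")
      case True
      then show ?thesis
        using attr_move[OF True] v YX by (auto simp: \<sigma>_def)
    next
      case False
      then show ?thesis
        using rest v \<sigma>T by (auto simp: \<sigma>_def eve_cert_def attr_base)
    qed
    then show "(v, \<sigma> v) \<in> E" "\<sigma> v \<in> X" by auto
  next
    fix C assume C: "C \<subseteq> X" "end_component (consistent VE \<sigma>) C"
    show "even_max C"
    proof (cases "C \<inter> ?Y = {}")
      case True
      have "end_component (consistent VE \<sigma>') C"
        by (rule end_component_mono[OF C(2)])
          (use True attr_base[of T ?P X] in \<open>auto simp: consistent_def \<sigma>_def\<close>)
      moreover have "C \<subseteq> X - ?Y" using True C(1) by auto
      ultimately show ?thesis by (rule eve_certD[OF rest])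
    next
      case False
      then obtain v where v: "v \<in> C" "v \<in> ?Y" by auto
      have "C \<inter> T \<noteq> {}"
      proof (rule attr_hits[OF v])
        fix v assume v: "v \<in> C" "v \<in> ?Y - T"
        obtain w where w: "w \<in> C" "(v, w) \<in> consistent VE \<sigma>"
          by (rule end_component_succ[OF C(2) v(1)])
        consider "v \<in> VE" | "v \<in> VN" "v \<notin> VE" | "v \<notin> ?P" by auto
        then show "\<exists>w\<in>C. w \<in> ?Y \<and> attr_rank ?P X T w < attr_rank ?P X T v"
        proof cases
          case 1
          then show ?thesis
            using w v attr_move[OF v(2)] by (auto simp: consistent_def \<sigma>_def)
        next
          case 2
          \<comment> \<open>An end component contains every successor of a random vertex, in
            particular one of smaller rank.\<close>
          then have "E `` {v} \<subseteq> C"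
            using C(2) v(1) by (auto simp: end_component_def)
          then show ?thesis
            using 2 attr_rank_less[OF v(2)] by auto
        next
          case 3
          then show ?thesis
            using attr_rank_less[OF v(2)] w C(1) by (auto simp: consistent_def)
        qed
      qed
      then show ?thesis
        using good[of \<sigma> C] C by (auto simp: \<sigma>_def)
    qed
  qed (use X in auto)
  then show ?thesis by blast
qed

text \<open>Gluing of two layers of Adam's region. A hopeful set that avoids the attractor of
  \<open>L'\<close> is hopeful for \<open>L''\<close>, because exits from the union are exits from
  \<open>L''\<close>. One that meets the attractor reaches \<open>L'\<close> by descent, and its
  part in \<open>L'\<close> is hopeful there: only a random vertex can lead out of
  \<open>L'\<close>, and this counts as an exit.\<close>

lemma adam_cert_attr:
  assumes X: "arena X" and D: "D \<subseteq> X" "\<And>v. v \<in> D \<inter> VE \<Longrightarrow> E `` {v} \<inter> X \<subseteq> D"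
    and L': "adam_cert D L' \<tau>'"
    and L'': "adam_cert (X - attr (- VE) X L') L'' \<tau>''"
  shows "\<exists>\<tau>. adam_cert X (attr (- VE) X L' \<union> L'') \<tau>"
proof -
  let ?B = "attr (- VE) X L'"
  let ?L = "?B \<union> L''"
  define \<tau> where "\<tau> v = (if v \<in> L' then \<tau>' v else if v \<in> ?B then attr_move (- VE) X L' v else \<tau>'' v)" for v
  have L'X: "L' \<subseteq> X" using L' D by (auto simp: adam_cert_def)
  have BX: "?B \<subseteq> X" by (rule attr_subset[OF L'X])
  have L'B: "L' \<subseteq> ?B" by (rule attr_base)
  have L''B: "L'' \<subseteq> X - ?B" using L'' by (auto simp: adam_cert_def)
  have eveL': "E `` {v} \<inter> X \<subseteq> L'" if "v \<in> L' \<inter> VE" for v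
    using that L' D(2)[of v] unfolding adam_cert_def by blast
  have "adam_cert X ?L \<tau>"
    unfolding adam_cert_def
  proof (intro conjI ballI allI impI)
    show "?L \<subseteq> X" using BX L''B by auto
  next
    fix v assume v: "v \<in> ?L \<inter> VE"
    consider "v \<in> L'" | "v \<in> ?B - L'" | "v \<in> L''" using v by auto
    then show "E `` {v} \<inter> X \<subseteq> ?L"
    proof cases
      case 1 then show ?thesis using eveL'[of v] v L'B by auto
    next
      case 2 then show ?thesis using attr_rank_less[OF 2] v by auto
    next
      case 3 then show ?thesis using L'' v by (auto simp: adam_cert_def)
    qed
  next
    fix v assume v: "v \<in> ?L \<inter> VA"
    have "(v, \<tau> v) \<in> E \<and> \<tau> v \<in> ?L"
    proof (cases "v \<in> ?B - L'")
      case True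
      then show ?thesis
        using attr_move[OF True] v by (auto simp: \<tau>_def)
    next
      case False
      then consider "v \<in> L'" | "v \<in> L''" "v \<notin> ?B" "v \<notin> L'" using v L'B L''B by auto
      then show ?thesis
        using L' L'' v L'B by cases (auto simp: \<tau>_def adam_cert_def)
    qed
    then show "(v, \<tau> v) \<in> E" "\<tau> v \<in> ?L" by auto
  next
    let ?F = "consistent VA \<tau>"
    fix R assume R: "R \<subseteq> ?L" "R \<noteq> {}"
    have RX: "R \<subseteq> X" using R(1) BX L''B by auto
    show "\<not> hopeful ?F ?L R"
    proof
      assume h: "hopeful ?F ?L R"
      show False
      proof (cases "R \<inter> ?B = {}")
        case True
        let ?F2 = "consistent VA \<tau>''"
        have RL: "R \<subseteq> L''" using R True by auto
        have sub: "?F \<inter> R \<times> R \<subseteq> ?F2"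
          using True L'B by (auto simp: \<tau>_def consistent_def)
        then have sub': "?F \<inter> R \<times> R \<subseteq> ?F2 \<inter> R \<times> R" by auto
        have "hopeful ?F2 L'' R"
          unfolding hopeful_def
        proof (intro conjI ballI)
          fix v assume "v \<in> R \<inter> VN"
          then show "E `` {v} \<inter> L'' \<subseteq> R" using h by (auto simp: hopeful_def)
        next
          fix v assume "v \<in> R"
          then obtain u where u: "(v, u) \<in> (?F \<inter> R \<times> R)\<^sup>*"
            "(\<exists>C\<subseteq>R. end_component ?F C \<and> even_max C \<and> u \<in> C) \<or> (u \<in> R \<inter> VN \<and> \<not> E `` {u} \<subseteq> ?L)"
            using h unfolding hopeful_def by meson
          have "end_component ?F2 C" if "end_component ?F C" "C \<subseteq> R" for C
            by (rule end_component_mono[OF that(1)]) (use that(2) sub in auto)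
          then show "\<exists>u. (v, u) \<in> (?F2 \<inter> R \<times> R)\<^sup>* \<and>
            ((\<exists>C\<subseteq>R. end_component ?F2 C \<and> even_max C \<and> u \<in> C) \<or> (u \<in> R \<inter> VN \<and> \<not> E `` {u} \<subseteq> L''))"
            using u rtrancl_mono[OF sub'] by blast
        qed
        from adam_certD[OF L'' this RL] show False using R(2) by simp
      next
        case False
        then obtain v where v: "v \<in> R" "v \<in> ?B" by auto
        have ne: "R \<inter> L' \<noteq> {}"
        proof (rule attr_hits[OF v])
          fix v assume v: "v \<in> R" "v \<in> ?B - L'"
          consider "v \<in> VN" "v \<notin> VE" | "v \<in> VA" | "v \<in> VE" "v \<notin> VN" using disjoint by auto
          then show "\<exists>w\<in>R. w \<in> ?B \<and> attr_rank (- VE) X L' w < attr_rank (- VE) X L' v"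
          proof cases
            case 1
            then show ?thesis
              using attr_rank_less[OF v(2)] v(1) h by (auto simp: hopeful_def)
          next
            case 2
            then obtain w where "w \<in> R" "(v, w) \<in> ?F" using hopeful_succ[OF h v(1)] by auto
            then show ?thesis
              using 2 attr_move[OF v(2)] v(2) by (auto simp: consistent_def \<tau>_def)
          next
            case 3
            then obtain w where "w \<in> R" "(v, w) \<in> ?F" using hopeful_succ[OF h v(1)] by auto
            then show ?thesis
              using 3 attr_rank_less[OF v(2)] RX by (auto simp: consistent_def)
          qed
        qed
        let ?F1 = "consistent VA \<tau>'" and ?R = "R \<inter> L'"
        \<comment> \<open>Eve's edges from \<open>L'\<close> stay in \<open>L'\<close> as long as
          they stay in \<open>X\<close>, and \<open>\<tau>'\<close> keeps Adam inside, so only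
          randomness can leave \<open>L'\<close>.\<close>
        have leave: "w \<in> L'" if "(v, w) \<in> ?F" "v \<in> L'" "w \<in> X" "v \<in> VN \<Longrightarrow> E `` {v} \<subseteq> L'" for v w
          using that L' eveL'[of v] unfolding adam_cert_def consistent_def
          by (cases "v \<in> VE"; cases "v \<in> VN") (auto simp: \<tau>_def)
        have sub: "?F \<inter> L' \<times> L' \<subseteq> ?F1"
          by (auto simp: \<tau>_def consistent_def)
        \<comment> \<open>A path of \<open>R\<close> that starts in \<open>L'\<close> either stays
          in \<open>L'\<close> or passes a random exit \<open>y\<close> beforehand. The alternative
          with \<open>y\<close> persists under further steps.\<close>
        have path: "(\<exists>y. (x, y) \<in> (?F1 \<inter> ?R \<times> ?R)\<^sup>* \<and> y \<in> ?R \<inter> VN \<and> \<not> E `` {y} \<subseteq> L') \<or>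
              (u \<in> L' \<and> (x, u) \<in> (?F1 \<inter> ?R \<times> ?R)\<^sup>*)"
          if "(x, u) \<in> (?F \<inter> R \<times> R)\<^sup>*" "x \<in> L'" for x u
          using that
        proof (induction rule: rtrancl_induct)
          case (step y z)
          then have yz: "(y, z) \<in> ?F" "y \<in> R" "z \<in> R" by auto
          show ?case
          proof (cases "y \<in> L' \<and> (x, y) \<in> (?F1 \<inter> ?R \<times> ?R)\<^sup>*")
            case True
            show ?thesis
            proof (cases "z \<in> L'")
              case z: True
              then have "(y, z) \<in> ?F1 \<inter> ?R \<times> ?R" using sub yz True by auto
              then show ?thesis using True z by (meson rtrancl.rtrancl_into_rtrancl)
            next
              case False
              then have "y \<in> VN" "\<not> E `` {y} \<subseteq> L'" using leave[of y z] yz True RX by auto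
              then show ?thesis using True yz by auto
            qed
          qed (use step.IH step.prems in blast)
        qed simp
        have "hopeful ?F1 L' ?R"
          unfolding hopeful_def
        proof (intro conjI ballI)
          fix v assume "v \<in> ?R \<inter> VN"
          then show "E `` {v} \<inter> L' \<subseteq> ?R" using h L'B by (auto simp: hopeful_def)
        next
          fix v assume v: "v \<in> ?R"
          let ?goal = "\<lambda>u. (\<exists>C\<subseteq>?R. end_component ?F1 C \<and> even_max C \<and> u \<in> C) \<or> (u \<in> ?R \<inter> VN \<and> \<not> E `` {u} \<subseteq> L')"
          obtain u where u: "(v, u) \<in> (?F \<inter> R \<times> R)\<^sup>*"
            "(\<exists>C\<subseteq>R. end_component ?F C \<and> even_max C \<and> u \<in> C) \<or> (u \<in> R \<inter> VN \<and> \<not> E `` {u} \<subseteq> ?L)"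
            using h v unfolding hopeful_def by (meson IntD1)
          from path[OF u(1)] v have "(\<exists>y. (v, y) \<in> (?F1 \<inter> ?R \<times> ?R)\<^sup>* \<and> ?goal y) \<or>
              (u \<in> L' \<and> (v, u) \<in> (?F1 \<inter> ?R \<times> ?R)\<^sup>*)" by blast
          then show "\<exists>u. (v, u) \<in> (?F1 \<inter> ?R \<times> ?R)\<^sup>* \<and> ?goal u"
          proof
            assume uL: "u \<in> L' \<and> (v, u) \<in> (?F1 \<inter> ?R \<times> ?R)\<^sup>*"
            show ?thesis
              using u(2)
            proof
              assume "u \<in> R \<inter> VN \<and> \<not> E `` {u} \<subseteq> ?L"
              then show ?thesis
                using uL L'B by (intro exI[of _ u] conjI disjI2) auto
            next
              assume "\<exists>C\<subseteq>R. end_component ?F C \<and> even_max C \<and> u \<in> C"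
              then obtain C where C: "C \<subseteq> R" "end_component ?F C" "even_max C" "u \<in> C" by auto
              show ?thesis
              proof (cases "C \<subseteq> L'")
                case True
                have "end_component ?F1 C"
                  by (rule end_component_mono[OF C(2)]) (use sub True in auto)
                then have "?goal u"
                  using C True by (intro disjI1 exI[of _ C]) auto
                then show ?thesis using uL by (intro exI[of _ u]) (rule conjI[OF conjunct2])
              next
                \<comment> \<open>The end component sticks out of \<open>L'\<close>: a path inside
                  it from \<open>u\<close> to an outer vertex \<open>z\<close> passes an exit, which
                  serves as the goal instead.\<close>
                case False
                then obtain z where z: "z \<in> C" "z \<notin> L'" by auto
                then have "(u, z) \<in> (?F \<inter> C \<times> C)\<^sup>*"
                  using C(2,4) by (auto simp: end_component_def intro: trancl_into_rtrancl)
                then have "(u, z) \<in> (?F \<inter> R \<times> R)\<^sup>*"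
                  by (rule rtrancl_mono[THEN subsetD, rotated]) (use C(1) in auto)
                from path[OF this] uL z obtain y where
                  "(u, y) \<in> (?F1 \<inter> ?R \<times> ?R)\<^sup>*" "y \<in> ?R \<inter> VN" "\<not> E `` {y} \<subseteq> L'" by blast
                then show ?thesis
                  using uL rtrancl_trans[of v u _ y] by (intro exI[of _ y] conjI disjI2) auto
              qed
            qed
          qed blast
        qed
        from adam_certD[OF L' this] ne show False by simp
      qed
    qed
  qed
  then show ?thesis by blast
qed

section \<open>Zielonka's recursion\<close>

abbreviation solved :: "'v set \<Rightarrow> bool" where
  "solved X \<equiv> \<exists>W L \<sigma> \<tau>. W \<union> L = X \<and> eve_cert X W \<sigma> \<and> adam_cert X L \<tau>"

lemma adam_cert_empty: "adam_cert X {} \<tau>"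
  by (auto simp: adam_cert_def)

lemma eve_cert_empty: "eve_cert X {} \<sigma>"
  by (auto simp: eve_cert_def end_component_def)

text \<open>Adam and randomness cannot leave \<open>Y\<close> within \<open>X\<close>, so closure of
  \<open>W\<close> relative to \<open>Y\<close> is closure relative to \<open>X\<close>.\<close>

lemma eve_cert_trap:
  assumes "eve_cert Y W \<sigma>" "Y \<subseteq> X" "\<And>v. v \<in> Y - VE \<Longrightarrow> E `` {v} \<inter> X \<subseteq> Y"
  shows "eve_cert X W \<sigma>"
proof -
  have W: "W \<subseteq> Y" using assms(1) by (simp add: eve_cert_def)
  have "E `` {v} \<inter> X \<subseteq> W" if "v \<in> W - VE" for v
  proof -
    have "E `` {v} \<inter> Y \<subseteq> W" using assms(1) that by (simp add: eve_cert_def)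
    then show ?thesis using assms(3)[of v] that W by auto
  qed
  then show ?thesis
    using assms(1,2) W by (simp add: eve_cert_def)
qed

text \<open>The common part of both parities. \<open>T\<close> is the set of vertices of maximal
  priority if this is even, and otherwise Eve's region in the complement of Adam's attractor of that
  set. As the strategy outside \<open>T\<close> is only constructed in the proof,
  \<open>good\<close> speaks of every \<open>\<sigma>\<close> that agrees with
  \<open>\<sigma>T\<close> on \<open>T\<close>.\<close>

lemma solved_if_target:
  assumes X: "arena X" and T: "T \<subseteq> X" "T \<noteq> {}"
    and IH: "\<And>Y. arena Y \<Longrightarrow> Y \<subset> X \<Longrightarrow> solved Y"
    and \<sigma>T: "\<And>v. v \<in> T \<inter> VE \<Longrightarrow> (v, \<sigma>T v) \<in> E \<and> \<sigma>T v \<in> X"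
    and good: "\<And>\<sigma> C. (\<And>v. v \<in> T \<inter> VE \<Longrightarrow> \<sigma> v = \<sigma>T v) \<Longrightarrow> C \<subseteq> X \<Longrightarrow>
       end_component (consistent VE \<sigma>) C \<Longrightarrow> C \<inter> T \<noteq> {} \<Longrightarrow> even_max C"
  shows "solved X"
proof -
  let ?D = "X - attr (VE \<union> VN) X T"
  have "arena ?D" "?D \<subset> X"
    using arena_minus_attr[OF X _ T(1), of "VE \<union> VN"] attr_base[of T "VE \<union> VN" X] T by auto
  from IH[OF this] obtain W' L' \<sigma>' \<tau>' where
    1: "W' \<union> L' = ?D" "eve_cert ?D W' \<sigma>'" "adam_cert ?D L' \<tau>'" by blast
  show ?thesis
  proof (cases "L' = {}")
    case True
    then have "eve_cert ?D ?D \<sigma>'" using 1(1,2) by simp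
    have "\<exists>\<sigma>. eve_cert X X \<sigma>"
    proof (rule eve_cert_attr[OF X T(1) \<open>eve_cert ?D ?D \<sigma>'\<close>, where \<sigma>T = \<sigma>T])
      show "(v, \<sigma>T v) \<in> E \<and> \<sigma>T v \<in> X" if "v \<in> T \<inter> VE" for v
        by (rule \<sigma>T[OF that])
      show "even_max C" if "\<And>v. v \<in> T \<inter> VE \<Longrightarrow> \<sigma> v = \<sigma>T v" "C \<subseteq> X"
        "end_component (consistent VE \<sigma>) C" "C \<inter> T \<noteq> {}" for \<sigma> C
        by (rule good[of \<sigma>]) (use that in auto)
    qed
    then obtain \<sigma> where "eve_cert X X \<sigma>" by blast
    then have "X \<union> {} = X \<and> eve_cert X X \<sigma> \<and> adam_cert X {} undefined"
      by (simp add: adam_cert_empty)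
    then show ?thesis by (intro exI)
  next
    case False
    let ?B = "attr (- VE) X L'"
    have L'X: "L' \<subseteq> X" using 1 by auto
    have "arena (X - ?B)" "X - ?B \<subset> X"
      using arena_minus_attr[OF X _ L'X, of "- VE"] attr_base[of L' "- VE" X] L'X False disjoint by auto
    from IH[OF this] obtain W'' L'' \<sigma>'' \<tau>'' where
      2: "W'' \<union> L'' = X - ?B" "eve_cert (X - ?B) W'' \<sigma>''" "adam_cert (X - ?B) L'' \<tau>''" by blast
    \<comment> \<open>From the complement of her own attractor Eve cannot enter the attractor; this
      is the trap condition for gluing Adam's layers.\<close>
    have "E `` {v} \<inter> X \<subseteq> ?D" if "v \<in> ?D \<inter> VE" for v
      using attr_helper[of v X "VE \<union> VN" T] that by auto
    then have "\<exists>\<tau>. adam_cert X (?B \<union> L'') \<tau>"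
      by (intro adam_cert_attr[OF X _ _ 1(3) 2(3)]) auto
    then obtain \<tau> where "adam_cert X (?B \<union> L'') \<tau>"
      by blast
    moreover have "eve_cert X W'' \<sigma>''"
    proof (rule eve_cert_trap[OF 2(2)])
      fix v assume "v \<in> X - ?B - VE"
      then show "E `` {v} \<inter> X \<subseteq> X - ?B"
        using attr_helper[of v X "- VE" L'] by auto
    qed auto
    moreover have "W'' \<union> (?B \<union> L'') = X"
      using 2(1) attr_subset[OF L'X, of "- VE"] by auto
    ultimately have "W'' \<union> (?B \<union> L'') = X \<and> eve_cert X W'' \<sigma>'' \<and> adam_cert X (?B \<union> L'') \<tau>"
      by simp
    then show ?thesis by (intro exI)
  qed
qed

lemma Max_prio_subset:
  assumes "C \<subseteq> X" "v \<in> C" "prio v = Max (prio ` X)"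
  shows "Max (prio ` C) = Max (prio ` X)"
  using assms by (intro antisym Max_mono Max_ge) (auto intro!: Max_ge simp flip: assms(3))

text \<open>An end component that meets the attractor contains a vertex of the maximal, odd
  priority. Even end components thus lie in the complement, where they contradict
  \<open>rest\<close>.\<close>

lemma adam_cert_attr_max:
  assumes X: "arena X" and T: "T = {v \<in> X. prio v = Max (prio ` X)}" and odd: "odd (Max (prio ` X))"
    and rest: "adam_cert (X - attr (- VE) X T) (X - attr (- VE) X T) \<tau>'"
  shows "\<exists>\<tau>. adam_cert X X \<tau>"
proof -
  let ?A = "attr (- VE) X T"
  have TX: "T \<subseteq> X" using T by auto
  have AX: "?A \<subseteq> X" by (rule attr_subset[OF TX])
  obtain f where f: "\<And>v. v \<in> X \<Longrightarrow> (v, f v) \<in> E \<and> f v \<in> X"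
    using X unfolding arena_def by metis
  define \<tau> where "\<tau> v = (if v \<in> T then f v else if v \<in> ?A then attr_move (- VE) X T v else \<tau>' v)" for v
  let ?F = "consistent VA \<tau>"
  have avoid: "C \<inter> ?A = {}" if C: "end_component ?F C" "even_max C" "C \<subseteq> X" for C
  proof (rule ccontr)
    assume "C \<inter> ?A \<noteq> {}"
    then obtain v where v: "v \<in> C" "v \<in> ?A" by auto
    have "C \<inter> T \<noteq> {}"
    proof (rule attr_hits[OF v])
      fix v assume v: "v \<in> C" "v \<in> ?A - T"
      obtain w where w: "w \<in> C" "(v, w) \<in> ?F"
        by (rule end_component_succ[OF C(1) v(1)])
      consider "v \<in> VA" | "v \<in> VN" "v \<notin> VE" | "v \<in> VE" using disjoint by auto
      then show "\<exists>w\<in>C. w \<in> ?A \<and> attr_rank (- VE) X T w < attr_rank (- VE) X T v"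
      proof cases
        case 1
        then show ?thesis
          using w v attr_move[OF v(2)] by (auto simp: consistent_def \<tau>_def)
      next
        case 2
        then have "E `` {v} \<subseteq> C"
          using C(1) v(1) by (auto simp: end_component_def)
        then show ?thesis
          using 2 attr_rank_less[OF v(2)] by auto
      next
        case 3
        then show ?thesis
          using attr_rank_less[OF v(2)] w C(3) by (auto simp: consistent_def)
      qed
    qed
    then show False
      using Max_prio_subset[OF C(3)] C(2) T odd by auto
  qed
  have "adam_cert X X \<tau>"
    unfolding adam_cert_def
  proof (intro conjI ballI allI impI)
    fix v assume v: "v \<in> X \<inter> VA"
    have "(v, \<tau> v) \<in> E \<and> \<tau> v \<in> X"
    proof (cases "v \<in> ?A - T")
      case True
      then show ?thesis
        using attr_move[OF True] v AX by (auto simp: \<tau>_def)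
    next
      case False
      then show ?thesis
        using f[of v] rest v attr_base[of T "- VE" X] by (auto simp: \<tau>_def adam_cert_def)
    qed
    then show "(v, \<tau> v) \<in> E" "\<tau> v \<in> X" by auto
  next
    fix R assume R: "R \<subseteq> X" "R \<noteq> {}"
    show "\<not> hopeful ?F X R"
    proof
      assume h: "hopeful ?F X R"
      obtain v where "v \<in> R" using R by auto
      then obtain u where "(\<exists>C\<subseteq>R. end_component ?F C \<and> even_max C \<and> u \<in> C) \<or> (u \<in> R \<inter> VN \<and> \<not> E `` {u} \<subseteq> X)"
        using h unfolding hopeful_def by meson
      \<comment> \<open>\<open>X\<close> is closed under randomness, so there is no exit, and the
        goal is an even end component.\<close>
      then obtain C where C: "C \<subseteq> R" "end_component ?F C" "even_max C"
        using X R(1) unfolding arena_def by blast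
      let ?F1 = "consistent VA \<tau>'"
      have CD: "C \<subseteq> X - ?A" using avoid[OF C(2,3)] C(1) R(1) by auto
      have C1: "end_component ?F1 C"
        by (rule end_component_mono[OF C(2)])
          (use CD attr_base[of T "- VE" X] in \<open>auto simp: \<tau>_def consistent_def\<close>)
      \<comment> \<open>An even end component is itself hopeful: it is closed under randomness and
        each vertex is its own goal.\<close>
      then have "hopeful ?F1 (X - ?A) C"
        using C(3) by (auto simp: hopeful_def end_component_def)
      from adam_certD[OF rest this CD] C1 show False
        by (simp add: end_component_def)
    qed
  qed auto
  then show ?thesis by blast
qed

lemma arena_solved: "arena X \<Longrightarrow> solved X"
proof (induction "card X" arbitrary: X rule: less_induct)
  case less
  have IH: "solved Y" if "arena Y" "Y \<subset> X" for Y
    using less.hyps[OF psubset_card_mono[OF _ that(2)] that(1)] by simp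
  show ?case
  proof (cases "X = {}")
    case True
    then have "{} \<union> {} = X \<and> eve_cert X {} undefined \<and> adam_cert X {} undefined"
      by (simp add: eve_cert_empty adam_cert_empty)
    then show ?thesis by (intro exI)
  next
    case False
    define d where "d = Max (prio ` X)"
    define T where "T = {v\<in>X. prio v = d}"
    have TX: "T \<subseteq> X" by (auto simp: T_def)
    have "d \<in> prio ` X" unfolding d_def by (rule Max_in) (use False in auto)
    then have T: "T \<noteq> {}" by (auto simp: T_def)
    show ?thesis
    proof (cases "even d")
      case True
      obtain f where f: "\<And>v. v \<in> X \<Longrightarrow> (v, f v) \<in> E \<and> f v \<in> X"
        using less.prems unfolding arena_def by metis
      show ?thesis
      proof (rule solved_if_target[OF less.prems TX T IH, where \<sigma>T = f])
        fix \<sigma> C assume "C \<subseteq> X" "C \<inter> T \<noteq> {}"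
        then show "even_max C"
          using Max_prio_subset[of C X] True by (auto simp: T_def d_def)
      qed (use f TX in auto)
    next
      case odd: False
      let ?D = "X - attr (- VE) X T"
      have "arena ?D" "?D \<subset> X"
        using arena_minus_attr[OF less.prems _ TX, of "- VE"] attr_base[of T "- VE" X] T TX disjoint by auto
      from IH[OF this] obtain W' L' \<sigma>' \<tau>' where
        1: "W' \<union> L' = ?D" "eve_cert ?D W' \<sigma>'" "adam_cert ?D L' \<tau>'" by blast
      show ?thesis
      proof (cases "W' = {}")
        case True
        then have "adam_cert ?D ?D \<tau>'" using 1(1,3) by simp
        from adam_cert_attr_max[OF less.prems T_def[unfolded d_def] odd[unfolded d_def] this]
        obtain \<tau> where "adam_cert X X \<tau>" by blast
        then have "{} \<union> X = X \<and> eve_cert X {} undefined \<and> adam_cert X X \<tau>"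
          by (simp add: eve_cert_empty)
        then show ?thesis by (intro exI)
      next
        case False
        have trap: "eve_cert X W' \<sigma>'"
        proof (rule eve_cert_trap[OF 1(2)])
          fix v assume "v \<in> ?D - VE"
          then show "E `` {v} \<inter> X \<subseteq> ?D"
            using attr_helper[of v X "- VE" T] by auto
        qed auto
        show ?thesis
        proof (rule solved_if_target[OF less.prems _ False IH, where \<sigma>T = \<sigma>'])
          show "W' \<subseteq> X" using 1 by auto
        next
          fix v assume "v \<in> W' \<inter> VE"
          then show "(v, \<sigma>' v) \<in> E \<and> \<sigma>' v \<in> X" using trap by (auto simp: eve_cert_def)
        next
          fix \<sigma> C assume *: "\<And>v. v \<in> W' \<inter> VE \<Longrightarrow> \<sigma> v = \<sigma>' v" "C \<subseteq> X"
            "end_component (consistent VE \<sigma>) C" "C \<inter> W' \<noteq> {}"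
          \<comment> \<open>Adam and randomness cannot leave \<open>W'\<close> within
            \<open>X\<close>, and on \<open>W'\<close> Eve follows \<open>\<sigma>'\<close>. An end
            component that meets \<open>W'\<close> is therefore trapped there and judged by the
            certificate of \<open>W'\<close>.\<close>
          have "C \<subseteq> W'"
          proof (rule end_component_subset[OF *(3,4)])
            fix v w assume vw: "v \<in> C" "v \<in> W'" "w \<in> C" "(v, w) \<in> consistent VE \<sigma>"
            show "w \<in> W'"
            proof (cases "v \<in> VE")
              case True
              then show ?thesis
                using vw *(1)[of v] trap by (auto simp: eve_cert_def consistent_def)
            next
              case False
              then have "E `` {v} \<inter> X \<subseteq> W'" using vw trap by (simp add: eve_cert_def)
              then show ?thesis using vw *(2) by (auto simp: consistent_def)
            qed
          qed
          moreover from this have "end_component (consistent VE \<sigma>') C"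
            by (intro end_component_mono[OF *(3)]) (use *(1) in \<open>auto simp: consistent_def\<close>)
          ultimately show "even_max C" by (rule eve_certD[OF trap, rotated])
        qed
      qed
    qed
  qed
qed

section \<open>From certificates to infinite fair paths\<close>

definition infs :: "(nat \<Rightarrow> 'v) \<Rightarrow> 'v set" where
  "infs p = {v. \<exists>\<^sub>\<infinity>n. p n = v}"

lemma eventually_infs: "\<exists>N. \<forall>n\<ge>N. p n \<in> infs p"
proof -
  have "\<forall>v\<in>- infs p. \<forall>\<^sub>\<infinity>n. p n \<noteq> v"
    by (auto simp: infs_def not_INFM)
  then have "\<forall>\<^sub>\<infinity>n. \<forall>v\<in>- infs p. p n \<noteq> v"
    by (simp add: eventually_ball_finite)
  then show ?thesis by (auto simp: MOST_nat_le)
qed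

lemma path_rtrancl:
  assumes "\<And>n. i \<le> n \<Longrightarrow> n < j \<Longrightarrow> (p n, p (Suc n)) \<in> F" "i \<le> j"
  shows "(p i, p j) \<in> F\<^sup>*"
  using assms(2,1)
proof (induction rule: dec_induct)
  case (step n)
  then have "(p i, p n) \<in> F\<^sup>*" "(p n, p (Suc n)) \<in> F" by auto
  then show ?case by (rule rtrancl_into_rtrancl)
qed auto

text \<open>From some time on the path stays in \<open>infs p\<close>, and it returns to each of its
  vertices, which yields strong connectivity. Closure under random edges is fairness.\<close>

lemma infs_end_component:
  assumes path: "\<And>n. (p n, p (Suc n)) \<in> F"
    and fair: "\<And>v w. v \<in> infs p \<Longrightarrow> v \<in> VN \<Longrightarrow> (v, w) \<in> E \<Longrightarrow> w \<in> infs p"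
  shows "end_component F (infs p)"
  unfolding end_component_def
proof (intro conjI ballI)
  obtain N where N: "\<And>n. N \<le> n \<Longrightarrow> p n \<in> infs p" using eventually_infs by blast
  then show "infs p \<noteq> {}" by auto
  show "E `` {v} \<subseteq> infs p" if "v \<in> infs p \<inter> VN" for v
    using fair that by auto
  fix u v assume "u \<in> infs p" "v \<in> infs p"
  obtain i where i: "N \<le> i" "p i = u"
    using \<open>u \<in> infs p\<close> by (auto simp: infs_def INFM_nat_le)
  \<comment> \<open>The bound \<open>Suc i\<close> makes the path from \<open>u\<close> to
    \<open>v\<close> nonempty even if \<open>u = v\<close>.\<close>
  obtain j where j: "Suc i \<le> j" "p j = v"
    using \<open>v \<in> infs p\<close> by (auto simp: infs_def INFM_nat_le)
  have step: "(p n, p (Suc n)) \<in> F \<inter> infs p \<times> infs p" if "i \<le> n" for n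
    using path N[of n] N[of "Suc n"] that i by auto
  have "(p (Suc i), p j) \<in> (F \<inter> infs p \<times> infs p)\<^sup>*"
    by (rule path_rtrancl) (use step j in auto)
  then show "(u, v) \<in> (F \<inter> infs p \<times> infs p)\<^sup>+"
    using step[of i] i(2) j(2) by (auto intro: rtrancl_into_trancl2)
qed

lemma eve_cert_path:
  assumes cert: "eve_cert UNIV W \<sigma>" and p0: "p 0 \<in> W"
    and path: "\<And>n. (p n, p (Suc n)) \<in> consistent VE \<sigma>"
    and fair: "\<And>v w. v \<in> infs p \<Longrightarrow> v \<in> VN \<Longrightarrow> (v, w) \<in> E \<Longrightarrow> w \<in> infs p"
  shows "even_max (infs p)"
proof -
  have step: "w \<in> W" if "v \<in> W" "(v, w) \<in> consistent VE \<sigma>" for v w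
  proof (cases "v \<in> VE")
    case True
    then show ?thesis using that cert by (auto simp: eve_cert_def consistent_def)
  next
    case False
    then have "E `` {v} \<subseteq> W" using that(1) cert by (simp add: eve_cert_def)
    then show ?thesis using that(2) by (auto simp: consistent_def)
  qed
  have "p n \<in> W" for n
    by (induction n) (use p0 step path in auto)
  then have W: "infs p \<subseteq> W" by (auto simp: infs_def INFM_nat_le)
  have "end_component (consistent VE \<sigma>) (infs p)"
    by (rule infs_end_component) (use path fair in auto)
  then show ?thesis using W by (rule eve_certD[OF cert])
qed

text \<open>\<open>Ps\<close> stands for all paths against one strategy of Eve, possibly with
  memory; \<open>branch\<close> says that it contains every random outcome. If every prefix had a
  fair even extension, the vertices reached while still inside \<open>L\<close> would form a
  nonempty hopeful set: such an extension either stays in \<open>L\<close>, and its infinity set is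
  an even end component, or first leaves \<open>L\<close> at a random exit.\<close>

lemma adam_cert_paths:
  assumes cert: "adam_cert UNIV L \<tau>"
    and ne: "Ps \<noteq> {}"
    and start: "\<And>p. p \<in> Ps \<Longrightarrow> p 0 \<in> L"
    and path: "\<And>p n. p \<in> Ps \<Longrightarrow> p n \<in> L \<Longrightarrow> (p n, p (Suc n)) \<in> consistent VA \<tau>"
    and branch: "\<And>p n w. p \<in> Ps \<Longrightarrow> p n \<in> VN \<Longrightarrow> (p n, w) \<in> E \<Longrightarrow>
       \<exists>q\<in>Ps. (\<forall>i\<le>n. q i = p i) \<and> q (Suc n) = w"
  shows "\<exists>p\<in>Ps. \<exists>n. \<forall>q\<in>Ps. (\<forall>i\<le>n. q i = p i) \<longrightarrow>
    (\<forall>v w. v \<in> infs q \<longrightarrow> v \<in> VN \<longrightarrow> (v, w) \<in> E \<longrightarrow> w \<in> infs q) \<longrightarrow> \<not> even_max (infs q)"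
proof (rule ccontr)
  assume "\<not> ?thesis"
  then have ext: "\<exists>q\<in>Ps. (\<forall>i\<le>n. q i = p i) \<and>
    (\<forall>v w. v \<in> infs q \<longrightarrow> v \<in> VN \<longrightarrow> (v, w) \<in> E \<longrightarrow> w \<in> infs q) \<and> even_max (infs q)"
    if "p \<in> Ps" for p n using that by blast
  let ?F = "consistent VA \<tau>"
  define R where "R = {p n |p n. p \<in> Ps \<and> (\<forall>i\<le>n. p i \<in> L)}"
  have RI: "p n \<in> R" if "p \<in> Ps" "\<And>i. i \<le> n \<Longrightarrow> p i \<in> L" for p n
    using that by (auto simp: R_def)
  have "hopeful ?F L R"
    unfolding hopeful_def
  proof (intro conjI ballI)
    fix v assume "v \<in> R \<inter> VN"
    then obtain p n where p: "v = p n" "p \<in> Ps" "\<And>i. i \<le> n \<Longrightarrow> p i \<in> L" "v \<in> VN"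
      by (auto simp: R_def)
    show "E `` {v} \<inter> L \<subseteq> R"
    proof
      fix w assume w: "w \<in> E `` {v} \<inter> L"
      then obtain q where q: "q \<in> Ps" "\<And>i. i \<le> n \<Longrightarrow> q i = p i" "q (Suc n) = w"
        using branch[of p n w] p by auto
      have "q i \<in> L" if "i \<le> Suc n" for i
        using q(2,3) p(3) w that by (cases "i = Suc n") auto
      from RI[OF q(1) this] q(3) show "w \<in> R" by auto
    qed
  next
    fix v assume "v \<in> R"
    then obtain p n where p: "v = p n" "p \<in> Ps" "\<And>i. i \<le> n \<Longrightarrow> p i \<in> L"
      by (auto simp: R_def)
    obtain q where q: "q \<in> Ps" "\<And>i. i \<le> n \<Longrightarrow> q i = p i"
      "\<And>v w. v \<in> infs q \<Longrightarrow> v \<in> VN \<Longrightarrow> (v, w) \<in> E \<Longrightarrow> w \<in> infs q" "even_max (infs q)"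
      using ext[OF p(2), of n] by blast
    have qL: "q i \<in> L" if "i \<le> n" for i using that q(2) p(3) by auto
    have qn: "q n = v" using q(2) p(1) by auto
    show "\<exists>u. (v, u) \<in> (?F \<inter> R \<times> R)\<^sup>* \<and>
        ((\<exists>C\<subseteq>R. end_component ?F C \<and> even_max C \<and> u \<in> C) \<or> (u \<in> R \<inter> VN \<and> \<not> E `` {u} \<subseteq> L))"
    proof (cases "\<forall>i. q i \<in> L")
      case True
      then have R: "q i \<in> R" for i using RI[OF q(1)] by auto
      obtain N where N: "\<And>i. N \<le> i \<Longrightarrow> q i \<in> infs q" using eventually_infs by blast
      have "end_component ?F (infs q)"
        by (rule infs_end_component) (use path[OF q(1)] q(3) True in auto)
      moreover have "infs q \<subseteq> R" using R by (auto simp: infs_def INFM_nat_le)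
      \<comment> \<open>By time \<open>max n N\<close> the given prefix is over and the path has
        entered its infinity set for good.\<close>
      moreover have "(v, q (max n N)) \<in> (?F \<inter> R \<times> R)\<^sup>*"
        unfolding qn[symmetric] by (rule path_rtrancl) (use path[OF q(1)] R True in auto)
      moreover have "q (max n N) \<in> infs q" using N by auto
      ultimately show ?thesis using q(4) by blast
    next
      case False
      define m where "m = (LEAST i. q i \<notin> L)"
      have m: "q m \<notin> L" unfolding m_def by (rule LeastI_ex) (use False in auto)
      have less: "q i \<in> L" if "i < m" for i
        using not_less_Least[of i "\<lambda>i. q i \<notin> L"] that by (auto simp: m_def)
      have "n < m" using m qL by (meson not_le_imp_less)
      then obtain k where k: "m = Suc k" "n \<le> k" by (cases m) auto
      have R: "q i \<in> R" if "i \<le> k" for i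
        by (rule RI[OF q(1)]) (use that k less in auto)
      have "(v, q k) \<in> (?F \<inter> R \<times> R)\<^sup>*"
        unfolding qn[symmetric] by (rule path_rtrancl) (use path[OF q(1)] R k less in auto)
      moreover have edge: "(q k, q m) \<in> ?F" using path[OF q(1), of k] k less by simp
      \<comment> \<open>\<open>k\<close> is the last index before the first departure from
        \<open>L\<close>; neither Eve nor Adam's \<open>\<tau>\<close> can leave
        \<open>L\<close>.\<close>
      have "q k \<in> VN"
      proof (rule ccontr)
        assume *: "q k \<notin> VN"
        have "q k \<in> L" using less k by auto
        with * edge cert have "q m \<in> L"
          by (cases "q k \<in> VE") (auto simp: adam_cert_def consistent_def)
        then show False using m by simp
      qed
      moreover have "\<not> E `` {q k} \<subseteq> L" using edge m by (auto simp: consistent_def)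
      ultimately show ?thesis using R[of k] by blast
    qed
  qed
  from adam_certD[OF cert this] have "R = {}" by (auto simp: R_def)
  moreover have "R \<noteq> {}"
  proof -
    obtain p where "p \<in> Ps" using ne by blast
    then have "p 0 \<in> R" using RI[of p 0] start by auto
    then show ?thesis by blast
  qed
  ultimately show False by simp
qed

end


section \<open>Plays, fairness and the Banach-Mazur game\<close>

context
  fixes G :: "('s::finite, 'a::finite) stochastic_game" and \<sigma> \<tau> :: "('s, 'a) strategy"
begin

definition act :: "(nat \<Rightarrow> 's) \<Rightarrow> nat \<Rightarrow> 'a" where
  "act \<omega> n = choice G \<sigma> \<tau> (hist G \<sigma> \<tau> \<omega> n) (\<omega> n)"

definition succs :: "(nat \<Rightarrow> 's) \<Rightarrow> nat \<Rightarrow> 's set" where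
  "succs \<omega> n = set_pmf (trans G (\<omega> n) (act \<omega> n))"

definition plays :: "'s \<Rightarrow> (nat \<Rightarrow> 's) set" where
  "plays s = {\<omega>. \<omega> 0 = s \<and> (\<forall>n. \<omega> (Suc n) \<in> succs \<omega> n)}"

definition visits :: "(nat \<Rightarrow> 's) \<Rightarrow> nat \<Rightarrow> 's \<Rightarrow> 'a \<Rightarrow> bool" where
  "visits \<omega> n q a \<longleftrightarrow> \<omega> n = q \<and> act \<omega> n = a"

definition fair :: "(nat \<Rightarrow> 's) \<Rightarrow> bool" where
  "fair \<omega> \<longleftrightarrow> (\<forall>q a t. t \<in> set_pmf (trans G q a) \<longrightarrow> (\<exists>\<^sub>\<infinity>n. visits \<omega> n q a) \<longrightarrow>
     (\<exists>\<^sub>\<infinity>n. visits \<omega> n q a \<and> \<omega> (Suc n) = t))"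

definition agree :: "nat \<Rightarrow> (nat \<Rightarrow> 's) \<Rightarrow> (nat \<Rightarrow> 's) \<Rightarrow> bool" where
  "agree n \<omega> \<omega>' \<longleftrightarrow> (\<forall>i\<le>n. \<omega> i = \<omega>' i)"

lemma agree_mono: "agree n \<omega> \<omega>' \<Longrightarrow> m \<le> n \<Longrightarrow> agree m \<omega> \<omega>'"
  by (auto simp: agree_def)

lemma agree_nth: "agree n \<omega> \<omega>' \<Longrightarrow> i \<le> n \<Longrightarrow> \<omega> i = \<omega>' i"
  by (auto simp: agree_def)

lemma agree_trans: "agree n \<omega> \<omega>' \<Longrightarrow> agree m \<omega>' \<omega>'' \<Longrightarrow> k \<le> n \<Longrightarrow> k \<le> m \<Longrightarrow> agree k \<omega> \<omega>''"
  by (auto simp: agree_def)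

lemma hist_agree: "agree n \<omega> \<omega>' \<Longrightarrow> hist G \<sigma> \<tau> \<omega> n = hist G \<sigma> \<tau> \<omega>' n"
  by (induction n) (auto simp: agree_def)

lemma act_agree: "agree n \<omega> \<omega>' \<Longrightarrow> act \<omega> n = act \<omega>' n"
  using hist_agree[of n \<omega> \<omega>'] by (auto simp: act_def agree_def)

lemma succs_agree: "agree n \<omega> \<omega>' \<Longrightarrow> succs \<omega> n = succs \<omega>' n"
  using act_agree[of n \<omega> \<omega>'] by (auto simp: succs_def agree_def)

lemma visits_agree: "agree n \<omega> \<omega>' \<Longrightarrow> i \<le> n \<Longrightarrow> visits \<omega> i q a = visits \<omega>' i q a"
  using act_agree[OF agree_mono[of n \<omega> \<omega>' i]] by (auto simp: visits_def agree_def)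

text \<open>The admissible next states depend only on the past and are never empty, so a legal
  prefix is continued by dependent choice.\<close>

lemma plays_prefix:
  assumes "\<omega> 0 = s" and \<omega>: "\<And>i. i < n \<Longrightarrow> \<omega> (Suc i) \<in> succs \<omega> i"
  shows "\<exists>\<omega>'\<in>plays s. agree n \<omega> \<omega>'"
proof -
  \<comment> \<open>\<open>P\<close> copies \<omega> up to index \<open>n\<close> and demands a
    legal successor at every positive index; the two demands are compatible by the hypothesis on
    \<omega>.\<close>
  define P where "P f x r \<longleftrightarrow> (x \<le> n \<longrightarrow> r = \<omega> x) \<and> (\<forall>y. x = Suc y \<longrightarrow> r \<in> succs f y)"
    for f :: "nat \<Rightarrow> 's" and x r
  have "\<exists>f. \<forall>x. P f x (f x)"
  proof (rule dependent_wellorder_choice)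
    fix r :: 's and f g :: "nat \<Rightarrow> 's" and x :: nat
    assume "\<And>y. y < x \<Longrightarrow> f y = g y"
    then have "agree y f g" if "x = Suc y" for y using that by (auto simp: agree_def)
    then show "P f x r = P g x r"
      using succs_agree[of _ f g] by (auto simp: P_def)
  next
    fix x and f :: "nat \<Rightarrow> 's" assume IH: "\<And>y. y < x \<Longrightarrow> P f y (f y)"
    show "\<exists>r. P f x r"
    proof (cases x)
      case 0
      then show ?thesis by (auto simp: P_def)
    next
      case (Suc y)
      have eq: "succs f y = succs \<omega> y" if "y \<le> n"
        by (rule succs_agree) (use IH Suc that in \<open>auto simp: agree_def P_def\<close>)
      obtain r where "r \<in> succs f y"
        unfolding succs_def using set_pmf_not_empty by fastforce
      then show ?thesis
        using eq \<omega>[of y] Suc by (cases "x \<le> n") (auto simp: P_def)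
    qed
  qed
  then obtain f where f: "\<And>x. P f x (f x)" by blast
  then have "f \<in> plays s" "agree n \<omega> f"
    using assms(1) by (auto simp: P_def plays_def agree_def)
  then show ?thesis by blast
qed

lemma plays_nonempty: "plays s \<noteq> {}"
  using plays_prefix[of "\<lambda>_. s" s 0] by auto

text \<open>Changing the state at \<open>Suc n\<close> leaves the successor sets up to index
  \<open>n\<close> intact, so the updated prefix is legal and can be continued.\<close>

lemma plays_extend:
  assumes "\<omega> \<in> plays s" "t \<in> succs \<omega> n"
  shows "\<exists>\<omega>'\<in>plays s. agree n \<omega> \<omega>' \<and> \<omega>' (Suc n) = t"
proof -
  let ?\<omega> = "fun_upd \<omega> (Suc n) t"
  have "succs ?\<omega> i = succs \<omega> i" if "i \<le> n" for i
    by (rule succs_agree) (use that in \<open>auto simp: agree_def\<close>)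
  then have "\<exists>\<omega>'\<in>plays s. agree (Suc n) ?\<omega> \<omega>'"
    by (intro plays_prefix) (use assms in \<open>auto simp: plays_def less_Suc_eq_le\<close>)
  then obtain \<omega>' where \<omega>': "\<omega>' \<in> plays s" "agree (Suc n) ?\<omega> \<omega>'" by blast
  have "agree n \<omega> \<omega>'"
    by (rule agree_trans[of n _ ?\<omega> "Suc n", OF _ \<omega>'(2)]) (auto simp: agree_def)
  moreover have "\<omega>' (Suc n) = t"
    using agree_nth[OF \<omega>'(2), of "Suc n"] by simp
  ultimately show ?thesis using \<omega>'(1) by blast
qed

definition word :: "(nat \<Rightarrow> 's) \<Rightarrow> nat \<Rightarrow> ('s, 'a) letter" where
  "word \<omega> k = (if even k then State (\<omega> (k div 2)) else Action (act \<omega> (k div 2)))"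

lemma state_seq_word [simp]: "state_seq (word \<omega>) = \<omega>"
  by (auto simp: state_seq_def word_def)

lemma pref_word: "pref (word \<omega>) (2 * n + 1) = hist G \<sigma> \<tau> \<omega> n"
proof (induction n)
  case (Suc n)
  have "pref (word \<omega>) (2 * Suc n + 1) =
    pref (word \<omega>) (2 * n + 1) @ [word \<omega> (2 * n + 1), word \<omega> (2 * Suc n)]"
    by (simp add: pref_def)
  also have "word \<omega> (2 * n + 1) = Action (act \<omega> n)" by (simp add: word_def)
  also have "word \<omega> (2 * Suc n) = State (\<omega> (Suc n))" by (simp add: word_def)
  finally show ?case
    using Suc by (simp add: act_def)
qed (simp add: pref_def word_def)

text \<open>The states up to index \<open>n\<close> also determine the action at letter
  \<open>2 * n + 1\<close>, hence \<open>2 * n + 2\<close> letters in all.\<close>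

lemma agree_word:
  assumes "agree n \<omega> \<omega>'" "k \<le> 2 * n + 2"
  shows "pref (word \<omega>) k = pref (word \<omega>') k"
proof -
  have "word \<omega> i = word \<omega>' i" if "i < k" for i
  proof -
    have "i div 2 \<le> n" using that assms(2) by auto
    then show ?thesis
      using act_agree[OF agree_mono[OF assms(1)]] agree_nth[OF assms(1)] by (auto simp: word_def)
  qed
  then show ?thesis by (auto simp: pref_def)
qed

lemma pref_eq_iff: "pref x k = pref y k \<longleftrightarrow> (\<forall>i<k. x i = y i)"
  by (auto simp: pref_def)

lemma word_agree:
  assumes "pref (word \<omega>) k = pref (word \<omega>') k" "2 * n < k"
  shows "agree n \<omega> \<omega>'"
  unfolding agree_def
proof (intro allI impI)
  fix i assume "i \<le> n"
  then have "word \<omega> (2 * i) = word \<omega>' (2 * i)"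
    using assms unfolding pref_eq_iff by auto
  then show "\<omega> i = \<omega>' i" by (simp add: word_def)
qed

lemma hist_snoc: "\<exists>w. hist G \<sigma> \<tau> \<omega> n = w @ [State (\<omega> n)]"
  by (cases n) auto

abbreviation tree :: "'s \<Rightarrow> (nat \<Rightarrow> ('s, 'a) letter) set" where
  "tree s \<equiv> residual_tree (induced_bm_game G) \<sigma> \<tau> s"

lemma choice_induced [simp]: "choice (induced_bm_game G) = choice G"
  by (simp add: choice_def induced_bm_game_def fun_eq_iff)

lemma BM_induced [simp]: "(q, a, t) \<in> BM (induced_bm_game G) \<longleftrightarrow> t \<in> set_pmf (trans G q a)"
  by (simp add: induced_bm_game_def pmf_positive_iff)

text \<open>Strategies are deterministic, so the actions can be recovered from the states, and
  branches of the residual tree amount to plays of the stochastic game.\<close>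

lemma tree_eq: "tree s = word ` plays s"
proof (intro equalityI subsetI)
  fix x assume "x \<in> word ` plays s"
  then obtain \<omega> where x: "x = word \<omega>" "\<omega> \<in> plays s" by auto
  have "hist G \<sigma> \<tau> \<omega> n \<in> residual_prefixes (induced_bm_game G) \<sigma> \<tau> s" for n
  proof (induction n)
    case 0
    then show ?case using x(2) by (auto simp: plays_def intro: residual_prefixes.root)
  next
    case (Suc n)
    obtain w where w: "hist G \<sigma> \<tau> \<omega> n = w @ [State (\<omega> n)]" using hist_snoc by blast
    have "w @ [State (\<omega> n), Action (act \<omega> n), State (\<omega> (Suc n))]
      \<in> residual_prefixes (induced_bm_game G) \<sigma> \<tau> s"
      by (rule residual_prefixes.step)
        (use Suc x(2) in \<open>auto simp: act_def plays_def succs_def simp flip: w\<close>)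
    then show ?case using w by (simp add: act_def)
  qed
  then show "x \<in> tree s"
    unfolding residual_tree_def x(1) by (simp only: mem_Collect_eq pref_word) simp
next
  fix x assume x: "x \<in> tree s"
  define \<omega> where "\<omega> = state_seq x"
  have in_tree: "pref x (2 * n + 1) \<in> residual_prefixes (induced_bm_game G) \<sigma> \<tau> s" for n
    using x by (auto simp: residual_tree_def)
  have even: "x (2 * n) = State (\<omega> n)" for n
    using residual_tree_alternates[OF x, of "2 * n"] by (auto simp: \<omega>_def state_seq_def)
  \<comment> \<open>The last three letters are displayed in the shape of the rule
    \<open>step\<close>, so that the inductive definition can be inverted.\<close>
  have pref3: "pref x (2 * Suc n + 1) = pref x (2 * n) @ [x (2 * n), x (2 * n + 1), x (2 * n + 2)]" for n
    by (simp add: pref_def)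
  have step: "x (2 * n + 1) = Action (choice G \<sigma> \<tau> (pref x (2 * n + 1)) (\<omega> n)) \<and>
      \<omega> (Suc n) \<in> set_pmf (trans G (\<omega> n) (choice G \<sigma> \<tau> (pref x (2 * n + 1)) (\<omega> n)))" for n
    using in_tree[of "Suc n"]
  proof cases
    case root
    then have "length (pref x (2 * Suc n + 1)) = 1" by simp
    then show ?thesis by (simp add: pref_def)
  next
    case (step w t a t')
    then have eq: "pref x (2 * n) = w" "x (2 * n) = State t" "x (2 * n + 1) = Action a"
      "x (2 * n + 2) = State t'"
      unfolding pref3 by auto
    moreover have "t = \<omega> n" "t' = \<omega> (Suc n)"
      using even[of n] even[of "Suc n"] eq by auto
    moreover have "pref x (2 * n + 1) = w @ [State t]"
      using eq by (simp add: pref_def)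
    ultimately show ?thesis using step by simp
  qed
  have root: "\<omega> 0 = s"
    using in_tree[of 0] even[of 0]
    by cases (auto simp: pref_def)
  have pref: "pref x (2 * n + 1) = hist G \<sigma> \<tau> \<omega> n" for n
  proof (induction n)
    case 0
    then show ?case using even[of 0] by (simp add: pref_def)
  next
    case (Suc n)
    have "pref x (2 * Suc n + 1) = pref x (2 * n + 1) @ [x (2 * n + 1), x (2 * Suc n)]"
      by (simp add: pref_def)
    then show ?case using Suc step[of n] even[of "Suc n"] by simp
  qed
  have odd: "x (2 * n + 1) = Action (act \<omega> n)" "\<omega> (Suc n) \<in> succs \<omega> n" for n
    using step[of n] unfolding pref by (simp_all add: act_def succs_def)
  have "x k = word \<omega> k" for k
    using even[of "k div 2"] odd(1)[of "k div 2"]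
    by (cases "even k") (simp_all add: word_def)
  then have "x = word \<omega>" by blast
  moreover have "\<omega> \<in> plays s"
    using root odd(2) by (simp add: plays_def)
  ultimately show "x \<in> word ` plays s" by blast
qed

section \<open>Forcing fairness in the Banach-Mazur game\<close>

lemma finite_prefixes_tree: "w \<in> finite_prefixes (tree s) \<longleftrightarrow> (\<exists>\<omega>\<in>plays s. w = pref (word \<omega>) (length w))"
  by (auto simp: finite_prefixes_def tree_eq pref_def)

text \<open>Some finite extension takes every transition that can still be taken, so a player of the
  Banach-Mazur game who keeps moving to such extensions makes the limit fair.\<close>

lemma realise_transitions:
  fixes Q :: "('s \<times> 'a \<times> 's) set"
  assumes "finite Q" and \<omega>: "\<omega> \<in> plays s"
  shows "\<exists>\<omega>'\<in>plays s. \<exists>N'\<ge>N. agree N \<omega> \<omega>' \<and> (\<forall>(q, a, t)\<in>Q. t \<in> set_pmf (trans G q a) \<longrightarrow>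
     (\<exists>i. N \<le> i \<and> i < N' \<and> visits \<omega>' i q a \<and> \<omega>' (Suc i) = t) \<or>
     (\<forall>\<omega>''\<in>plays s. agree N' \<omega>' \<omega>'' \<longrightarrow> (\<forall>i\<ge>N'. \<not> visits \<omega>'' i q a)))"
  using assms(1)
proof induction
  case empty
  then show ?case using \<omega> by (auto simp: agree_def)
next
  case (insert p Q)
  let ?real = "\<lambda>\<omega>' N' (q, a, t). t \<in> set_pmf (trans G q a) \<longrightarrow>
     (\<exists>i. N \<le> i \<and> i < N' \<and> visits \<omega>' i q a \<and> \<omega>' (Suc i) = t) \<or>
     (\<forall>\<omega>''\<in>plays s. agree N' \<omega>' \<omega>'' \<longrightarrow> (\<forall>i\<ge>N'. \<not> visits \<omega>'' i q a))"
  obtain \<omega>' N' where \<omega>': "\<omega>' \<in> plays s" "N \<le> N'" "agree N \<omega> \<omega>'" "\<And>p. p \<in> Q \<Longrightarrow> ?real \<omega>' N' p"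
    using insert.IH by blast
  obtain q a t where p: "p = (q, a, t)" by (cases p)
  show ?case
  \<comment> \<open>Either the pair can still occur after the current prefix, and then the prefix is
    extended through it and on to \<open>t\<close>, or the transition is impossible or already
    hopeless.\<close>
  proof (cases "t \<in> set_pmf (trans G q a) \<and> (\<exists>\<omega>''\<in>plays s. agree N' \<omega>' \<omega>'' \<and> (\<exists>i\<ge>N'. visits \<omega>'' i q a))")
    case False
    then have "?real \<omega>' N' p" using p by auto
    then show ?thesis using \<omega>' by (intro bexI[of _ \<omega>'] exI[of _ N']) auto
  next
    case True
    then obtain \<omega>2 i where \<omega>2: "\<omega>2 \<in> plays s" "agree N' \<omega>' \<omega>2" "i \<ge> N'" "visits \<omega>2 i q a"
      and t: "t \<in> set_pmf (trans G q a)" by blast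
    then have "t \<in> succs \<omega>2 i" by (auto simp: succs_def visits_def)
    then obtain \<omega>3 where \<omega>3: "\<omega>3 \<in> plays s" "agree i \<omega>2 \<omega>3" "\<omega>3 (Suc i) = t"
      using plays_extend \<omega>2(1) by blast
    have 23: "agree N' \<omega>' \<omega>3"
      using \<omega>2(2,3) \<omega>3(2) by (auto intro: agree_trans)
    \<comment> \<open>Earlier entries survive the extension: realised transitions lie in the old
      prefix, and what no continuation can visit stays excluded in a longer prefix.\<close>
    have "?real \<omega>3 (Suc i) r" if rQ: "r \<in> Q" for r
    proof -
      obtain q' a' t' where r: "r = (q', a', t')" by (cases r)
      show ?thesis
        unfolding r prod.case
      proof
        assume "t' \<in> set_pmf (trans G q' a')"
        then consider j where "N \<le> j" "j < N'" "visits \<omega>' j q' a'" "\<omega>' (Suc j) = t'"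
          | "\<And>\<omega>'' i. \<omega>'' \<in> plays s \<Longrightarrow> agree N' \<omega>' \<omega>'' \<Longrightarrow> i \<ge> N' \<Longrightarrow> \<not> visits \<omega>'' i q' a'"
          using \<omega>'(4)[OF rQ] r by auto
        then show "(\<exists>j. N \<le> j \<and> j < Suc i \<and> visits \<omega>3 j q' a' \<and> \<omega>3 (Suc j) = t') \<or>
           (\<forall>\<omega>''\<in>plays s. agree (Suc i) \<omega>3 \<omega>'' \<longrightarrow> (\<forall>j\<ge>Suc i. \<not> visits \<omega>'' j q' a'))"
        proof cases
          case (1 j)
          then show ?thesis
            using visits_agree[OF 23, of j] agree_nth[OF 23, of "Suc j"] \<omega>2(3)
            by (intro disjI1 exI[of _ j]) auto
        next
          case 2
          have "\<not> visits \<omega>'' j q' a'" if "\<omega>'' \<in> plays s" "agree (Suc i) \<omega>3 \<omega>''" "j \<ge> Suc i" for \<omega>'' j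
            by (rule 2[OF that(1) agree_trans[OF 23 that(2)]]) (use that(3) \<omega>2(3) in auto)
          then show ?thesis by blast
        qed
      qed
    qed
    moreover have "visits \<omega>3 i q a"
      using visits_agree[OF \<omega>3(2), of i] \<omega>2(4) by auto
    then have "?real \<omega>3 (Suc i) p"
      using \<omega>3(3) \<omega>2(3) \<omega>'(2) p by (auto intro!: exI[of _ i])
    moreover have "agree N \<omega> \<omega>3" using \<omega>'(2,3) 23 by (auto intro: agree_trans)
    ultimately show ?thesis
      using \<omega>3(1) \<omega>'(2) \<omega>2(3) by (intro bexI[of _ \<omega>3] exI[of _ "Suc i"]) auto
  qed
qed

text \<open>Ranging over all plays through \<open>w'\<close> makes this a property of two finite
  words. Word lengths serve as generous bounds on state indices (state \<open>i\<close> is letter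
  \<open>2 * i\<close>); it only matters that they tend to infinity.\<close>

definition fair_move :: "'s \<Rightarrow> ('s, 'a) letter list \<Rightarrow> ('s, 'a) letter list \<Rightarrow> bool" where
  "fair_move s w w' \<longleftrightarrow> strict_prefix w w' \<and> w' \<in> finite_prefixes (tree s) \<and>
     (\<forall>q a t. t \<in> set_pmf (trans G q a) \<longrightarrow>
        (\<forall>\<omega>\<in>plays s. pref (word \<omega>) (length w') = w' \<longrightarrow>
           (\<exists>i\<ge>length w. visits \<omega> i q a \<and> \<omega> (Suc i) = t)) \<or>
        (\<forall>\<omega>\<in>plays s. pref (word \<omega>) (length w') = w' \<longrightarrow> (\<forall>i\<ge>length w'. \<not> visits \<omega> i q a)))"

lemma fair_move_exists:
  assumes "w \<in> finite_prefixes (tree s)"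
  shows "\<exists>w'. fair_move s w w'"
proof -
  obtain \<omega> where \<omega>: "\<omega> \<in> plays s" "w = pref (word \<omega>) (length w)"
    using assms finite_prefixes_tree by blast
  obtain \<omega>' N where \<omega>': "\<omega>' \<in> plays s" "length w \<le> N" "agree (length w) \<omega> \<omega>'"
    and real: "\<And>q a t. t \<in> set_pmf (trans G q a) \<Longrightarrow>
     (\<exists>i. length w \<le> i \<and> i < N \<and> visits \<omega>' i q a \<and> \<omega>' (Suc i) = t) \<or>
     (\<forall>\<omega>''\<in>plays s. agree N \<omega>' \<omega>'' \<longrightarrow> (\<forall>i\<ge>N. \<not> visits \<omega>'' i q a))"
    using realise_transitions[OF finite[of UNIV] \<omega>(1), of "length w"] by force
  \<comment> \<open>\<open>2 * N + 1\<close> letters fix the states up to index \<open>N\<close>,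
    and thus every transition made before time \<open>N\<close>.\<close>
  define w' where "w' = pref (word \<omega>') (2 * N + 1)"
  have len: "length w' = 2 * N + 1" by (simp add: w'_def pref_def)
  have agree: "agree N \<omega>' \<omega>''" if "pref (word \<omega>'') (length w') = w'" for \<omega>''
    by (rule word_agree[of _ "2 * N + 1"]) (use that len in \<open>simp_all add: w'_def\<close>)
  have "take (length w) w' = pref (word \<omega>') (length w)"
    using \<omega>'(2) by (simp add: w'_def pref_def take_map)
  also have "\<dots> = w"
    using agree_word[OF \<omega>'(3), of "length w"] \<omega>(2) by simp
  finally have "prefix w w'" by (metis take_is_prefix)
  then have "strict_prefix w w'"
    using len \<omega>'(2) by (auto simp: strict_prefix_def)
  moreover have "w' \<in> finite_prefixes (tree s)"
    using \<omega>'(1) len finite_prefixes_tree w'_def by metis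
  moreover have "(\<forall>\<omega>\<in>plays s. pref (word \<omega>) (length w') = w' \<longrightarrow>
           (\<exists>i\<ge>length w. visits \<omega> i q a \<and> \<omega> (Suc i) = t)) \<or>
        (\<forall>\<omega>\<in>plays s. pref (word \<omega>) (length w') = w' \<longrightarrow> (\<forall>i\<ge>length w'. \<not> visits \<omega> i q a))"
    if "t \<in> set_pmf (trans G q a)" for q a t
    using real[OF that]
  proof
    assume "\<exists>i. length w \<le> i \<and> i < N \<and> visits \<omega>' i q a \<and> \<omega>' (Suc i) = t"
    then obtain i where i: "length w \<le> i" "i < N" "visits \<omega>' i q a" "\<omega>' (Suc i) = t" by blast
    have "visits \<omega>'' i q a \<and> \<omega>'' (Suc i) = t" if "pref (word \<omega>'') (length w') = w'" for \<omega>''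
      using visits_agree[OF agree[OF that], of i] agree_nth[OF agree[OF that], of "Suc i"] i by auto
    then show ?thesis using i(1) by blast
  qed (use agree len in auto)
  ultimately show ?thesis unfolding fair_move_def by blast
qed

lemma bm_play_length:
  assumes "bm_play X w"
  shows "n \<le> length (w n)"
proof (induction n)
  case (Suc n)
  have "length (w n) < length (w (Suc n))"
    using assms by (auto simp: bm_play_def intro: prefix_length_less)
  then show ?case using Suc by simp
qed simp

lemma bm_limit_pref:
  assumes "bm_play X w"
  shows "w n = pref (bm_limit w) (length (w n))"
  using bm_limit_unique[OF assms, of "bm_limit w"] by blast

text \<open>The tree is a closed set: membership is tested on prefixes, and every prefix of the
  limit is a prefix of some move.\<close>

lemma bm_limit_in_tree:
  assumes "bm_play (tree s) w"
  shows "bm_limit w \<in> tree s"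
  unfolding residual_tree_def
proof (intro CollectI allI)
  fix n :: nat
  let ?m = "2 * n + 1"
  have "w ?m \<in> finite_prefixes (tree s)" using assms by (auto simp: bm_play_def)
  then obtain y where y: "y \<in> tree s" "w ?m = pref y (length (w ?m))"
    by (auto simp: finite_prefixes_def pref_def)
  then have "pref (bm_limit w) (length (w ?m)) = pref y (length (w ?m))"
    using bm_limit_pref[OF assms, of ?m] by simp
  then have "pref (bm_limit w) ?m = pref y ?m"
    using bm_play_length[OF assms, of ?m] unfolding pref_eq_iff by auto
  then show "pref (bm_limit w) ?m \<in> residual_prefixes (induced_bm_game G) \<sigma> \<tau> s"
    using y(1) by (simp add: residual_tree_def)
qed

text \<open>If \<open>(q, a)\<close> recurs in the limit, the second alternative of
  \<open>fair_move\<close> fails at every fair move, so each of them realises the transition at a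
  later and later index.\<close>

lemma fair_bm_limit:
  assumes w: "bm_play (tree s) w" and inf: "\<exists>\<^sub>\<infinity>n. fair_move s (w n) (w (Suc n))"
  shows "\<exists>\<omega>\<in>plays s. fair \<omega> \<and> bm_limit w = word \<omega>"
proof -
  obtain \<omega> where \<omega>: "\<omega> \<in> plays s" "bm_limit w = word \<omega>"
    using bm_limit_in_tree[OF w] tree_eq by auto
  have "fair \<omega>"
    unfolding fair_def
  proof (intro allI impI)
    fix q a t assume t: "t \<in> set_pmf (trans G q a)" and io: "\<exists>\<^sub>\<infinity>n. visits \<omega> n q a"
    show "\<exists>\<^sub>\<infinity>n. visits \<omega> n q a \<and> \<omega> (Suc n) = t"
      unfolding INFM_nat_le
    proof
      fix m
      obtain n where n: "m \<le> n" "fair_move s (w n) (w (Suc n))"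
        using inf by (auto simp: INFM_nat_le)
      have pref: "pref (word \<omega>) (length (w (Suc n))) = w (Suc n)"
        using bm_limit_pref[OF w, of "Suc n"] \<omega>(2) by simp
      obtain k where "k \<ge> length (w (Suc n))" "visits \<omega> k q a"
        using io by (auto simp: INFM_nat_le)
      then obtain i where "i \<ge> length (w n)" "visits \<omega> i q a" "\<omega> (Suc i) = t"
        using n(2) t \<omega>(1) pref unfolding fair_move_def by blast
      moreover have "m \<le> length (w n)" using n(1) bm_play_length[OF w, of n] by simp
      ultimately show "\<exists>i\<ge>m. visits \<omega> i q a \<and> \<omega> (Suc i) = t" using order_trans by blast
    qed
  qed
  then show ?thesis using \<omega> by blast
qed

lemma bm_position_snoc:
  assumes "bm_position X ws" "w \<in> finite_prefixes X" "strict_prefix (last ws) w"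
  shows "bm_position X (ws @ [w])"
  using assms unfolding bm_position_def
  by (auto simp: nth_append last_conv_nth less_Suc_eq split: if_splits)
     (metis One_nat_def diff_Suc_1)

text \<open>Banach answers every position by a fair move from its last word; his infinitely many
  moves make the limit fair.\<close>

lemma banach_wins_if_fair:
  assumes "\<And>\<omega>. \<omega> \<in> plays s \<Longrightarrow> fair \<omega> \<Longrightarrow> \<omega> \<in> \<Phi>"
  shows "banach_wins (tree s) {x. state_seq x \<in> \<Phi>}"
proof -
  define f where "f w = (SOME w'. fair_move s w w')" for w
  have f: "fair_move s w (f w)" if "w \<in> finite_prefixes (tree s)" for w
    unfolding f_def by (rule someI_ex[OF fair_move_exists[OF that]])
  show ?thesis
    unfolding banach_wins_def
  proof (intro exI[of _ "\<lambda>ws. f (last ws)"] conjI allI impI)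
    show "banach_strategy (tree s) (\<lambda>ws. f (last ws))"
      unfolding banach_strategy_def
    proof (intro allI impI, elim conjE)
      fix ws assume ws: "bm_position (tree s) ws"
      then have "last ws \<in> finite_prefixes (tree s)" by (auto simp: bm_position_def)
      then show "bm_position (tree s) (ws @ [f (last ws)])"
        using f[of "last ws"] ws by (intro bm_position_snoc) (auto simp: fair_move_def)
    qed
  next
    fix w assume w: "bm_play (tree s) w \<and> (\<forall>n. odd n \<longrightarrow> w n = f (last (pref w n)))"
    have "fair_move s (w n) (w (Suc n))" if "even n" for n
    proof -
      have "w (Suc n) = f (last (pref w (Suc n)))" using w that by auto
      then show ?thesis using f[of "w n"] w by (simp add: pref_def bm_play_def)
    qed
    then have "\<exists>n\<ge>m. fair_move s (w n) (w (Suc n))" for m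
      by (intro exI[of _ "2 * m"]) auto
    then have "\<exists>\<^sub>\<infinity>n. fair_move s (w n) (w (Suc n))"
      by (simp add: INFM_nat_le)
    from fair_bm_limit[OF conjunct1[OF w] this] obtain \<omega> where
      "\<omega> \<in> plays s" "fair \<omega>" "bm_limit w = word \<omega>" by blast
    then show "bm_limit w \<in> {x. state_seq x \<in> \<Phi>}" using assms by simp
  qed
qed

text \<open>Mazur opens with the given prefix of \<omega> and then makes fair moves himself, while
  Banach follows a winning strategy. The limit is fair by Mazur's moves and satisfies the objective
  by Banach's.\<close>

lemma fair_if_banach_wins:
  assumes win: "banach_wins (tree s) {x. state_seq x \<in> \<Phi>}" and \<omega>: "\<omega> \<in> plays s"
  shows "\<exists>\<omega>'\<in>plays s. agree n \<omega> \<omega>' \<and> fair \<omega>' \<and> \<omega>' \<in> \<Phi>"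
proof -
  obtain \<beta> where \<beta>: "banach_strategy (tree s) \<beta>"
    and wins: "\<And>w. bm_play (tree s) w \<Longrightarrow> (\<And>n. odd n \<Longrightarrow> w n = \<beta> (pref w n)) \<Longrightarrow> state_seq (bm_limit w) \<in> \<Phi>"
    using win unfolding banach_wins_def by blast
  define f where "f w = (SOME w'. fair_move s w w')" for w
  have f: "fair_move s w (f w)" if "w \<in> finite_prefixes (tree s)" for w
    unfolding f_def by (rule someI_ex[OF fair_move_exists[OF that]])
  let ?w0 = "pref (word \<omega>) (2 * n + 1)"
  \<comment> \<open>An odd number of moves made so far means that Banach is to move.\<close>
  define move where "move ws = (if odd (length ws) then \<beta> ws else f (last ws))" for ws
  define pos where "pos = rec_nat [?w0] (\<lambda>_ ws. ws @ [move ws])"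
  have pos_simps: "pos 0 = [?w0]" "pos (Suc k) = pos k @ [move (pos k)]" for k
    by (simp_all add: pos_def)
  have position: "bm_position (tree s) (pos k)" for k
  proof (induction k)
    case 0
    have "?w0 \<in> finite_prefixes (tree s)"
      using \<omega> tree_eq by (auto simp: finite_prefixes_def)
    then show ?case by (simp add: pos_simps bm_position_def)
  next
    case (Suc k)
    show ?case
    proof (cases "odd (length (pos k))")
      case True
      then show ?thesis
        using \<beta> Suc by (simp add: pos_simps move_def banach_strategy_def)
    next
      case False
      have "last (pos k) \<in> finite_prefixes (tree s)"
        using Suc by (auto simp: bm_position_def)
      then show ?thesis
        using f[of "last (pos k)"] Suc False
        by (auto simp: pos_simps move_def fair_move_def intro!: bm_position_snoc)
    qed
  qed
  define w where "w k = last (pos k)" for k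
  have pos_eq: "pos k = pref w (Suc k)" for k
    by (induction k) (simp_all add: pos_simps pref_def w_def)
  have w_Suc: "w (Suc k) = move (pref w (Suc k))" for k
    by (simp add: w_def pos_simps flip: pos_eq)
  have play: "bm_play (tree s) w"
    unfolding bm_play_def
  proof
    fix k
    have "bm_position (tree s) (pref w (Suc (Suc k)))" using position[of "Suc k"] pos_eq by simp
    then have "w k \<in> finite_prefixes (tree s)"
      "strict_prefix (pref w (Suc (Suc k)) ! k) (pref w (Suc (Suc k)) ! Suc k)"
      by (auto simp: bm_position_def pref_def)
    then show "w k \<in> finite_prefixes (tree s) \<and> strict_prefix (w k) (w (Suc k))"
      by (simp add: pref_def nth_append)
  qed
  have "w k = \<beta> (pref w k)" if "odd k" for k
    using that w_Suc[of "k - 1"] by (cases k) (auto simp: move_def pref_def)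
  from wins[OF play this] have in_\<Phi>: "state_seq (bm_limit w) \<in> \<Phi>" .
  have "fair_move s (w k) (w (Suc k))" if "odd k" for k
    using that w_Suc[of k] f[of "w k"] play by (simp add: move_def pref_def bm_play_def)
  then have "\<exists>k\<ge>m. fair_move s (w k) (w (Suc k))" for m
    by (intro exI[of _ "2 * m + 1"]) auto
  then have "\<exists>\<^sub>\<infinity>k. fair_move s (w k) (w (Suc k))"
    by (simp add: INFM_nat_le)
  from fair_bm_limit[OF play this] obtain \<omega>' where
    \<omega>': "\<omega>' \<in> plays s" "fair \<omega>'" "bm_limit w = word \<omega>'" by blast
  have "w 0 = ?w0" by (simp add: w_def pos_simps)
  then have "pref (word \<omega>) (2 * n + 1) = pref (word \<omega>') (2 * n + 1)"
    using bm_limit_pref[OF play, of 0] \<omega>'(3) by (simp add: pref_def)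
  then have "agree n \<omega> \<omega>'" by (rule word_agree) simp
  then show ?thesis using \<omega>' in_\<Phi> by auto
qed

end


section \<open>Fairness in the play measure\<close>

context
  fixes G :: "('s::finite, 'a::finite) stochastic_game" and \<sigma> \<tau> :: "('s, 'a) strategy" and s :: 's
begin

interpretation IT: Ionescu_Tulcea "\<lambda>n \<omega>. measure_pmf (next_state G \<sigma> \<tau> s n \<omega>)" "\<lambda>_. count_space UNIV"
  by (rule Ionescu_Tulcea_next_state)

interpretation prob_space "play_measure G \<sigma> \<tau> s"
  by (rule prob_space_play_measure)

abbreviation (input) \<PP> where "\<PP> \<equiv> play_measure G \<sigma> \<tau> s"

abbreviation (input) nxt where "nxt \<equiv> next_state G \<sigma> \<tau> s"

lemma space_play_measure [simp]: "space \<PP> = UNIV"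
  using sets_eq_imp_space_eq[OF sets_play_measure[of G \<sigma> \<tau> s]] by (simp add: space_PiM)

lemma next_state_cong:
  assumes "\<And>i. i < n \<Longrightarrow> \<omega> i = \<omega>' i"
  shows "nxt n \<omega> = nxt n \<omega>'"
proof (cases n)
  case (Suc m)
  then have "agree m \<omega> \<omega>'" using assms by (auto simp: agree_def)
  from hist_agree[OF this, of G \<sigma> \<tau>] show ?thesis
    using Suc assms[of m] by (simp add: next_state_def)
qed (simp add: next_state_def)

section \<open>Integration of functions of finitely many states\<close>

lemma sets_PiM_finite:
  assumes "finite J"
  shows "sets (PiM J (\<lambda>_. count_space (UNIV :: 's set))) = Pow (space (PiM J (\<lambda>_. count_space UNIV)))"
proof -
  let ?M = "PiM J (\<lambda>_. count_space (UNIV :: 's set))"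
  have fin: "finite (space ?M)"
    using assms by (auto simp: space_PiM intro!: finite_PiE)
  have sing: "{x} \<in> sets ?M" if "x \<in> space ?M" for x
  proof -
    have "{x} = (\<Pi>\<^sub>E i\<in>J. {x i})"
      using that by (simp add: space_PiM PiE_iff PiE_singleton)
    then show ?thesis using assms by (auto intro!: sets_PiM_I_finite)
  qed
  have "A \<in> sets ?M" if A: "A \<subseteq> space ?M" for A
  proof -
    have "(\<Union>x\<in>A. {x}) \<in> sets ?M"
      using A fin sing by (intro sets.finite_UN) (auto intro: finite_subset)
    then show ?thesis by simp
  qed
  then show ?thesis using sets.sets_into_space by blast
qed

lemma measurable_PiM_finite:
  "finite J \<Longrightarrow> (\<And>x. f x \<in> space N) \<Longrightarrow> f \<in> PiM J (\<lambda>_. count_space (UNIV :: 's set)) \<rightarrow>\<^sub>M N"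
  by (rule measurableI) (auto simp: sets_PiM_finite)

lemma measurable_restrict_play_measure:
  "(\<lambda>\<omega>. restrict \<omega> J) \<in> \<PP> \<rightarrow>\<^sub>M PiM J (\<lambda>_. count_space UNIV)"
  unfolding measurable_cong_sets[OF sets_play_measure refl]
  by (rule measurable_restrict_subset) simp

text \<open>Such a function factors through a finite product of finite discrete spaces, where every
  set is measurable.\<close>

lemma measurable_prefix_fun:
  assumes "\<And>\<omega> \<omega>'. agree n \<omega> \<omega>' \<Longrightarrow> f \<omega> = f \<omega>'" "\<And>\<omega>. f \<omega> \<in> space N"
  shows "f \<in> \<PP> \<rightarrow>\<^sub>M N"
proof -
  have "(\<lambda>\<omega>. f (restrict \<omega> {0..<Suc n})) \<in> \<PP> \<rightarrow>\<^sub>M N"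
    by (rule measurable_compose[OF measurable_restrict_play_measure measurable_PiM_finite])
      (use assms(2) in auto)
  moreover have "f (restrict \<omega> {0..<Suc n}) = f \<omega>" for \<omega>
    by (rule assms(1)) (auto simp: agree_def)
  ultimately show ?thesis by simp
qed

text \<open>Marginals of the projective limit on initial segments are compositions of kernels,
  started at \<open>\<lambda>_. undefined\<close>, the only point of the empty product.\<close>

lemma distr_play_measure:
  "distr \<PP> (PiM {0..<n} (\<lambda>_. count_space UNIV)) (\<lambda>\<omega>. restrict \<omega> {0..<n}) = IT.C 0 n (\<lambda>_. undefined)"
proof -
  have "distr \<PP> (PiM {0..<n} (\<lambda>_. count_space UNIV)) (\<lambda>\<omega>. restrict \<omega> {0..<n}) = IT.CI {0..<n}"
    unfolding play_measure_def by (rule IT.distr_lim) simp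
  also have "\<dots> = IT.C 0 n (\<lambda>_. undefined)"
  proof (rule measure_eqI)
    show "sets (IT.CI {0..<n}) = sets (IT.C 0 n (\<lambda>_. undefined))"
      by (simp add: IT.sets_C IT.PF.sets_P)
    fix A assume "A \<in> sets (IT.CI {0..<n})"
    then have A: "A \<in> sets (PiM {0..<n} (\<lambda>_. count_space UNIV))"
      by (simp add: IT.PF.sets_P)
    then show "emeasure (IT.CI {0..<n}) A = emeasure (IT.C 0 n (\<lambda>_. undefined)) A"
      using sets.sets_into_space[OF A]
      by (subst IT.emeasure_CI[OF subset_refl A]) (simp add: prod_emb_id space_PiM)
  qed
  finally show ?thesis .
qed

lemma nn_integral_prefix_fun:
  assumes "\<And>\<omega> \<omega>'. (\<And>i. i < n \<Longrightarrow> \<omega> i = \<omega>' i) \<Longrightarrow> f \<omega> = f \<omega>'"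
  shows "(\<integral>\<^sup>+\<omega>. f \<omega> \<partial>\<PP>) = (\<integral>\<^sup>+\<omega>. f \<omega> \<partial>IT.C 0 n (\<lambda>_. undefined))"
proof -
  have "(\<integral>\<^sup>+\<omega>. f \<omega> \<partial>IT.C 0 n (\<lambda>_. undefined)) = (\<integral>\<^sup>+\<omega>. f (restrict \<omega> {0..<n}) \<partial>\<PP>)"
    unfolding distr_play_measure[symmetric]
    by (rule nn_integral_distr[OF measurable_restrict_play_measure])
      (unfold measurable_distr_eq1, rule measurable_PiM_finite, auto)
  also have "\<dots> = (\<integral>\<^sup>+\<omega>. f \<omega> \<partial>\<PP>)"
    by (intro nn_integral_cong assms) auto
  finally show ?thesis ..
qed

text \<open>The tower property: the state at time \<open>n\<close> is integrated out first, by its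
  conditional distribution given the earlier states.\<close>

lemma nn_integral_step:
  assumes "\<And>\<omega> \<omega>'. agree n \<omega> \<omega>' \<Longrightarrow> f \<omega> = f \<omega>'"
  shows "(\<integral>\<^sup>+\<omega>. f \<omega> \<partial>\<PP>) = (\<integral>\<^sup>+\<omega>. (\<integral>\<^sup>+t. f (fun_upd \<omega> n t) \<partial>measure_pmf (nxt n \<omega>)) \<partial>\<PP>)"
proof -
  let ?M = "\<lambda>n. PiM {0..<n} (\<lambda>_. count_space (UNIV :: 's set))"
  let ?C = "\<lambda>n. IT.C 0 n (\<lambda>_. undefined)"
  have undef: "(\<lambda>_. undefined) \<in> space (?M 0)" by (simp add: space_PiM PiE_def extensional_def)
  have spC: "space (?C n) = space (?M n)"
    using IT.space_C[OF undef, of n] by simp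
  have setsC: "sets (?C n) = sets (?M n)"
    using IT.sets_C[OF undef, of n] by simp
  have "(\<integral>\<^sup>+\<omega>. f \<omega> \<partial>\<PP>) = (\<integral>\<^sup>+\<omega>. f \<omega> \<partial>?C (Suc n))"
    by (rule nn_integral_prefix_fun) (rule assms, auto simp: agree_def)
  also have "\<dots> = (\<integral>\<^sup>+\<omega>. \<integral>\<^sup>+\<omega>'. f \<omega>' \<partial>IT.eP n \<omega> \<partial>?C n)"
    unfolding IT.C.simps add_0
  proof (rule nn_integral_bind)
    show "f \<in> borel_measurable (?M (Suc n))"
      by (rule measurable_PiM_finite) auto
    show "IT.eP n \<in> ?C n \<rightarrow>\<^sub>M subprob_algebra (?M (Suc n))"
      using IT.measurable_eP[of n] unfolding measurable_cong_sets[OF setsC refl] .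
  qed
  also have "\<dots> = (\<integral>\<^sup>+\<omega>. \<integral>\<^sup>+t. f (fun_upd \<omega> n t) \<partial>measure_pmf (nxt n \<omega>) \<partial>?C n)"
  proof (rule nn_integral_cong)
    fix \<omega> assume "\<omega> \<in> space (?C n)"
    then have \<omega>: "\<omega> \<in> space (?M n)" using spC by simp
    show "(\<integral>\<^sup>+\<omega>'. f \<omega>' \<partial>IT.eP n \<omega>) = (\<integral>\<^sup>+t. f (fun_upd \<omega> n t) \<partial>measure_pmf (nxt n \<omega>))"
      by (rule IT.nn_integral_eP[OF \<omega>]) (rule measurable_PiM_finite, auto)
  qed
  also have "\<dots> = (\<integral>\<^sup>+\<omega>. (\<integral>\<^sup>+t. f (fun_upd \<omega> n t) \<partial>measure_pmf (nxt n \<omega>)) \<partial>\<PP>)"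
  proof (rule nn_integral_prefix_fun[symmetric])
    fix \<omega> \<omega>' :: "nat \<Rightarrow> 's" assume *: "\<And>i. i < n \<Longrightarrow> \<omega> i = \<omega>' i"
    have "f (fun_upd \<omega> n t) = f (fun_upd \<omega>' n t)" for t
      by (rule assms) (use * in \<open>auto simp: agree_def\<close>)
    then show "(\<integral>\<^sup>+t. f (fun_upd \<omega> n t) \<partial>measure_pmf (nxt n \<omega>)) =
      (\<integral>\<^sup>+t. f (fun_upd \<omega>' n t) \<partial>measure_pmf (nxt n \<omega>'))"
      using next_state_cong[OF *] by simp
  qed
  finally show ?thesis .
qed

lemma next_state_Suc: "nxt (Suc n) \<omega> = trans G (\<omega> n) (act G \<sigma> \<tau> \<omega> n)"
  by (simp add: next_state_def act_def)

text \<open>In the inner integral of the tower property the state is drawn from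
  \<open>nxt n \<omega>\<close> itself, so the failure indicator integrates to 0.\<close>

lemma AE_next_state: "AE \<omega> in \<PP>. \<omega> n \<in> set_pmf (nxt n \<omega>)"
proof -
  let ?I = "\<lambda>\<omega>. indicator {\<omega>. \<omega> n \<notin> set_pmf (nxt n \<omega>)} \<omega> :: ennreal"
  have dep: "?I \<omega> = ?I \<omega>'" if "agree n \<omega> \<omega>'" for \<omega> \<omega>'
  proof -
    have "nxt n \<omega> = nxt n \<omega>'" "\<omega> n = \<omega>' n"
      using that next_state_cong[of n \<omega> \<omega>'] by (auto simp: agree_def)
    then show ?thesis by (simp add: indicator_def)
  qed
  have "nxt n (fun_upd \<omega> n t) = nxt n \<omega>" for \<omega> t
    by (rule next_state_cong) auto
  then have "(\<integral>\<^sup>+t. ?I (fun_upd \<omega> n t) \<partial>measure_pmf (nxt n \<omega>)) = 0" for \<omega>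
    by (auto simp: nn_integral_0_iff_AE AE_measure_pmf_iff)
  then have "(\<integral>\<^sup>+\<omega>. ?I \<omega> \<partial>\<PP>) = 0"
    by (subst nn_integral_step[of n]) (use dep in auto)
  moreover have "?I \<in> borel_measurable \<PP>"
    by (rule measurable_prefix_fun[of n]) (use dep in auto)
  ultimately have "AE \<omega> in \<PP>. ?I \<omega> = 0"
    by (simp add: nn_integral_0_iff_AE)
  then show ?thesis
    by eventually_elim (auto simp: indicator_def split: if_splits)
qed

lemma AE_plays: "AE \<omega> in \<PP>. \<omega> \<in> plays G \<sigma> \<tau> s"
proof -
  have "AE \<omega> in \<PP>. \<forall>n. \<omega> n \<in> set_pmf (nxt n \<omega>)"
    using AE_next_state by (simp add: AE_all_countable)
  then show ?thesis
  proof eventually_elim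
    case (elim \<omega>)
    have "\<omega> (Suc n) \<in> succs G \<sigma> \<tau> \<omega> n" for n
      using elim[rule_format, of "Suc n"] by (simp add: succs_def next_state_Suc)
    moreover have "\<omega> 0 = s"
      using elim[rule_format, of 0] by (simp add: next_state_def)
    ultimately show ?case by (simp add: plays_def)
  qed
qed

text \<open>Each further prescribed state multiplies the measure of the cone by its transition
  probability, which is positive along a play.\<close>

lemma cone_positive:
  assumes "\<omega> \<in> plays G \<sigma> \<tau> s"
  shows "emeasure \<PP> {\<omega>'. agree n \<omega> \<omega>'} > 0"
proof -
  have pos: "\<omega> n \<in> set_pmf (nxt n \<omega>)" for n
    using assms by (cases n) (auto simp: plays_def next_state_Suc succs_def next_state_def[of _ _ _ _ 0])
  have meas: "{\<omega>'. \<forall>i<n. \<omega> i = \<omega>' i} \<in> sets \<PP>" for n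
  proof -
    have "(\<lambda>\<omega>'. \<forall>i<n. \<omega> i = \<omega>' i) \<in> \<PP> \<rightarrow>\<^sub>M count_space UNIV"
      by (rule measurable_prefix_fun[of n]) (auto simp: agree_def)
    then show ?thesis by (simp add: pred_def)
  qed
  \<comment> \<open>The strict bound lets the induction start at the whole space; the cone of
    \<open>agree n\<close> is the instance \<open>Suc n\<close>.\<close>
  have "emeasure \<PP> {\<omega>'. \<forall>i<n. \<omega> i = \<omega>' i} > 0" for n
  proof (induction n)
    case 0
    then show ?case using emeasure_space_1 by simp
  next
    case (Suc n)
    let ?A = "\<lambda>n. {\<omega>'. \<forall>i<n. \<omega> i = \<omega>' i}"
    let ?p = "ennreal (pmf (nxt n \<omega>) (\<omega> n))"
    have "emeasure \<PP> (?A (Suc n)) = (\<integral>\<^sup>+\<omega>'. indicator (?A (Suc n)) \<omega>' \<partial>\<PP>)"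
      using meas by simp
    also have "\<dots> = (\<integral>\<^sup>+\<omega>'. (\<integral>\<^sup>+t. indicator (?A (Suc n)) (fun_upd \<omega>' n t) \<partial>measure_pmf (nxt n \<omega>')) \<partial>\<PP>)"
      by (rule nn_integral_step) (auto simp: agree_def indicator_def)
    also have "\<dots> = (\<integral>\<^sup>+\<omega>'. ?p * indicator (?A n) \<omega>' \<partial>\<PP>)"
    proof (rule nn_integral_cong)
      fix \<omega>'
      have "(\<integral>\<^sup>+t. indicator (?A (Suc n)) (fun_upd \<omega>' n t) \<partial>measure_pmf (nxt n \<omega>')) =
        (\<integral>\<^sup>+t. indicator (?A n) \<omega>' * indicator {\<omega> n} t \<partial>measure_pmf (nxt n \<omega>'))"
        by (intro nn_integral_cong) (auto simp: indicator_def less_Suc_eq)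
      also have "\<dots> = indicator (?A n) \<omega>' * ennreal (pmf (nxt n \<omega>') (\<omega> n))"
        by (simp add: nn_integral_cmult emeasure_pmf_single)
      also have "\<dots> = ?p * indicator (?A n) \<omega>'"
        using next_state_cong[of n \<omega> \<omega>'] by (auto simp: indicator_def)
      finally show "(\<integral>\<^sup>+t. indicator (?A (Suc n)) (fun_upd \<omega>' n t) \<partial>measure_pmf (nxt n \<omega>')) =
        ?p * indicator (?A n) \<omega>'" .
    qed
    also have "\<dots> = ?p * emeasure \<PP> (?A n)"
      using meas by (simp add: nn_integral_cmult)
    finally show ?case
      using Suc pos[of n] by (simp add: ennreal_zero_less_mult_iff pmf_positive)
  qed
  from this[of "Suc n"] show ?thesis
    by (simp add: agree_def less_Suc_eq_le)
qed

section \<open>Almost sure fairness by a betting argument\<close>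

context
  fixes q :: 's and a :: 'a and t :: 's and m :: nat
  assumes t: "t \<in> set_pmf (trans G q a)"
begin

text \<open>A gambler bets, from time \<open>m\<close> on, against the transition from \<open>(q, a)\<close> to \<open>t\<close>. Her capital is a
  nonnegative supermartingale that would tend to infinity if \<open>(q, a)\<close> occurred infinitely often
  without ever being followed by \<open>t\<close>.\<close>

definition bet :: "(nat \<Rightarrow> 's) \<Rightarrow> nat \<Rightarrow> ennreal" where
  "bet \<omega> n = (if m \<le> n \<and> visits G \<sigma> \<tau> \<omega> n q a
     then (if \<omega> (Suc n) = t then 0 else ennreal (1 + pmf (trans G q a) t)) else 1)"

definition capital :: "nat \<Rightarrow> (nat \<Rightarrow> 's) \<Rightarrow> ennreal" where
  "capital n \<omega> = (\<Prod>i<n. bet \<omega> i)"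

lemma bet_agree: "agree (Suc n) \<omega> \<omega>' \<Longrightarrow> bet \<omega> n = bet \<omega>' n"
  using visits_agree[of "Suc n" \<omega> \<omega>' n G \<sigma> \<tau>] agree_nth[of "Suc n" \<omega> \<omega>' "Suc n"]
  by (simp add: bet_def)

lemma capital_agree: "agree n \<omega> \<omega>' \<Longrightarrow> capital n \<omega> = capital n \<omega>'"
  unfolding capital_def
  by (intro prod.cong refl bet_agree) (auto intro: agree_mono)

text \<open>At a bet the expected factor is \<open>(1 + p) * (1 - p)\<close>, at most 1. The payoff
  \<open>1 + p\<close> stays finite for \<open>p = 1\<close>, unlike the fair payoff
  \<open>1 / (1 - p)\<close>.\<close>

lemma expected_bet:
  "(\<integral>\<^sup>+t'. bet (fun_upd \<omega> (Suc n) t') n \<partial>measure_pmf (nxt (Suc n) \<omega>)) \<le> 1"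
proof -
  let ?p = "pmf (trans G q a) t"
  have "agree n (fun_upd \<omega> (Suc n) t') \<omega>" for t' by (simp add: agree_def)
  then have v: "visits G \<sigma> \<tau> (fun_upd \<omega> (Suc n) t') n q a = visits G \<sigma> \<tau> \<omega> n q a" for t'
    using visits_agree by blast
  show ?thesis
  proof (cases "m \<le> n \<and> visits G \<sigma> \<tau> \<omega> n q a")
    case True
    then have "nxt (Suc n) \<omega> = trans G q a" by (simp add: next_state_Suc visits_def)
    then have "(\<integral>\<^sup>+t'. bet (fun_upd \<omega> (Suc n) t') n \<partial>measure_pmf (nxt (Suc n) \<omega>)) =
      (\<integral>\<^sup>+t'. ennreal (1 + ?p) * indicator (- {t}) t' \<partial>measure_pmf (trans G q a))"
      using True by (auto simp: bet_def v indicator_def intro!: nn_integral_cong)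
    also have "\<dots> = ennreal (1 + ?p) * ennreal (1 - ?p)"
      using measure_pmf.prob_compl[of "{t}" "trans G q a"]
      by (simp add: nn_integral_cmult measure_pmf.emeasure_eq_measure Compl_eq_Diff_UNIV measure_pmf_single)
    also have "\<dots> = ennreal (1 - ?p * ?p)"
      by (subst ennreal_mult[symmetric]) (auto simp: pmf_le_1 algebra_simps)
    also have "\<dots> \<le> 1" by simp
    finally show ?thesis .
  next
    case False
    then have "bet (fun_upd \<omega> (Suc n) t') n = 1" for t' by (auto simp: bet_def v)
    then show ?thesis by simp
  qed
qed

lemma expected_capital: "(\<integral>\<^sup>+\<omega>. capital n \<omega> \<partial>\<PP>) \<le> 1"
proof (induction n)
  case 0
  then show ?case using emeasure_space_1 by (simp add: capital_def)
next
  case (Suc n)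
  have "(\<integral>\<^sup>+\<omega>. capital (Suc n) \<omega> \<partial>\<PP>) =
    (\<integral>\<^sup>+\<omega>. (\<integral>\<^sup>+t'. capital (Suc n) (fun_upd \<omega> (Suc n) t') \<partial>measure_pmf (nxt (Suc n) \<omega>)) \<partial>\<PP>)"
    by (rule nn_integral_step[OF capital_agree])
  also have "\<dots> \<le> (\<integral>\<^sup>+\<omega>. capital n \<omega> \<partial>\<PP>)"
  proof (rule nn_integral_mono)
    fix \<omega>
    have "capital n (fun_upd \<omega> (Suc n) t') = capital n \<omega>" for t'
      by (rule capital_agree) (simp add: agree_def)
    then have "(\<integral>\<^sup>+t'. capital (Suc n) (fun_upd \<omega> (Suc n) t') \<partial>measure_pmf (nxt (Suc n) \<omega>)) =
      (\<integral>\<^sup>+t'. capital n \<omega> * bet (fun_upd \<omega> (Suc n) t') n \<partial>measure_pmf (nxt (Suc n) \<omega>))"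
      by (simp add: capital_def)
    also have "\<dots> = capital n \<omega> * (\<integral>\<^sup>+t'. bet (fun_upd \<omega> (Suc n) t') n \<partial>measure_pmf (nxt (Suc n) \<omega>))"
      by (rule nn_integral_cmult) simp
    also have "\<dots> \<le> capital n \<omega> * 1"
      by (intro mult_left_mono expected_bet) simp
    finally show "(\<integral>\<^sup>+t'. capital (Suc n) (fun_upd \<omega> (Suc n) t') \<partial>measure_pmf (nxt (Suc n) \<omega>)) \<le> capital n \<omega>"
      by simp
  qed
  finally show ?case using Suc by order
qed

text \<open>Fatou's lemma: expected capital is at most 1 at all times, hence so is the expectation
  of the liminf.\<close>

lemma AE_liminf_capital: "AE \<omega> in \<PP>. liminf (\<lambda>n. capital n \<omega>) \<noteq> \<infinity>"
proof (rule nn_integral_PInf_AE)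
  have meas: "capital n \<in> borel_measurable \<PP>" for n
    by (rule measurable_prefix_fun[OF capital_agree]) auto
  then show "(\<lambda>\<omega>. liminf (\<lambda>n. capital n \<omega>)) \<in> borel_measurable \<PP>" by measurable
  have "(\<integral>\<^sup>+\<omega>. liminf (\<lambda>n. capital n \<omega>) \<partial>\<PP>) \<le> liminf (\<lambda>n. \<integral>\<^sup>+\<omega>. capital n \<omega> \<partial>\<PP>)"
    by (rule nn_integral_liminf[OF meas])
  also have "\<dots> \<le> liminf (\<lambda>n. 1 :: ennreal)"
    by (intro Liminf_mono always_eventually allI expected_capital)
  also have "\<dots> = 1" by (simp add: Liminf_const)
  finally show "(\<integral>\<^sup>+\<omega>. liminf (\<lambda>n. capital n \<omega>) \<partial>\<PP>) \<noteq> \<infinity>"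
    by (auto simp: top_unique)
qed

text \<open>If every bet is won, the capital never decreases, and each visit after time
  \<open>m\<close> multiplies it by a constant greater than 1.\<close>

lemma capital_unbounded:
  assumes io: "\<exists>\<^sub>\<infinity>n. visits G \<sigma> \<tau> \<omega> n q a"
    and no: "\<And>n. m \<le> n \<Longrightarrow> visits G \<sigma> \<tau> \<omega> n q a \<Longrightarrow> \<omega> (Suc n) \<noteq> t"
  shows "liminf (\<lambda>n. capital n \<omega>) = \<infinity>"
proof -
  let ?c = "1 + pmf (trans G q a) t"
  have bet: "bet \<omega> n = (if m \<le> n \<and> visits G \<sigma> \<tau> \<omega> n q a then ennreal ?c else 1)" for n
    using no by (simp add: bet_def)
  have mono: "capital i \<omega> \<le> capital j \<omega>" if "i \<le> j" for i j
    using that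
  proof (induction rule: dec_induct)
    case (step n)
    have "1 \<le> bet \<omega> n" by (simp add: bet)
    then have "capital n \<omega> * 1 \<le> capital n \<omega> * bet \<omega> n" by (intro mult_left_mono) simp_all
    then show ?case using step by (simp add: capital_def)
  qed simp
  have "\<exists>n. ennreal (?c ^ k) \<le> capital n \<omega>" for k
  proof (induction k)
    case 0
    show ?case by (intro exI[of _ 0]) (simp add: capital_def)
  next
    case (Suc k)
    then obtain n where n: "ennreal (?c ^ k) \<le> capital n \<omega>" by blast
    obtain i where i: "i \<ge> max n m" "visits G \<sigma> \<tau> \<omega> i q a"
      using io unfolding INFM_nat_le by blast
    have "ennreal (?c ^ Suc k) = ennreal (?c ^ k) * ennreal ?c"
      by (subst ennreal_mult[symmetric]) (simp_all add: mult.commute)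
    also have "\<dots> \<le> capital i \<omega> * ennreal ?c"
      using n mono[of n i] i(1) by (intro mult_right_mono) auto
    also have "\<dots> = capital (Suc i) \<omega>"
      using i by (simp add: capital_def bet)
    finally show ?case by blast
  qed
  then have le: "ennreal (?c ^ k) \<le> liminf (\<lambda>n. capital n \<omega>)" for k
    using mono by (intro Liminf_bounded) (meson eventually_at_top_linorderI order_trans)
  show ?thesis
  proof (cases "liminf (\<lambda>n. capital n \<omega>)")
    case (real r)
    have "?c > 1" using t by (simp add: pmf_positive)
    then obtain k where "r < ?c ^ k" using real_arch_pow by blast
    then show ?thesis using le[of k] real by (simp add: ennreal_le_iff)
  qed simp
qed

lemma AE_transition:
  "AE \<omega> in \<PP>. (\<exists>\<^sub>\<infinity>n. visits G \<sigma> \<tau> \<omega> n q a) \<longrightarrow> (\<exists>n\<ge>m. visits G \<sigma> \<tau> \<omega> n q a \<and> \<omega> (Suc n) = t)"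
  using AE_liminf_capital
proof eventually_elim
  case (elim \<omega>)
  then show ?case using capital_unbounded[of \<omega>] by blast
qed

end

text \<open>Countably many almost sure events are intersected; ranging over all \<open>m\<close>
  turns one occurrence after \<open>m\<close> into infinitely many.\<close>

lemma AE_fair: "AE \<omega> in \<PP>. fair G \<sigma> \<tau> \<omega>"
proof -
  have "AE \<omega> in \<PP>. t \<in> set_pmf (trans G q a) \<longrightarrow> (\<exists>\<^sub>\<infinity>n. visits G \<sigma> \<tau> \<omega> n q a) \<longrightarrow>
      (\<exists>n\<ge>m. visits G \<sigma> \<tau> \<omega> n q a \<and> \<omega> (Suc n) = t)" for q a t m
    using AE_transition by (cases "t \<in> set_pmf (trans G q a)") auto
  then have "AE \<omega> in \<PP>. \<forall>q a t m. t \<in> set_pmf (trans G q a) \<longrightarrow> (\<exists>\<^sub>\<infinity>n. visits G \<sigma> \<tau> \<omega> n q a) \<longrightarrow>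
      (\<exists>n\<ge>m. visits G \<sigma> \<tau> \<omega> n q a \<and> \<omega> (Suc n) = t)"
    unfolding AE_all_countable by blast
  then show ?thesis
    by eventually_elim (auto simp: fair_def INFM_nat_le)
qed

lemma almost_sure_if_fair:
  assumes "\<And>\<omega>. \<omega> \<in> plays G \<sigma> \<tau> s \<Longrightarrow> fair G \<sigma> \<tau> \<omega> \<Longrightarrow> \<omega> \<in> \<Phi>" "\<Phi> \<in> sets \<PP>"
  shows "measure \<PP> \<Phi> = 1"
proof -
  have "AE \<omega> in \<PP>. \<omega> \<in> \<Phi>"
    using AE_fair AE_plays by eventually_elim (rule assms(1))
  then show ?thesis using assms(2) by (simp add: prob_eq_1)
qed

text \<open>The probabilistic counterpart of \<open>fair_if_banach_wins\<close>: otherwise the cone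
  of the prefix would be a null set, against \<open>cone_positive\<close>.\<close>

lemma fair_if_almost_sure:
  assumes as: "measure \<PP> \<Phi> = 1" and "\<Phi> \<in> sets \<PP>" and \<omega>: "\<omega> \<in> plays G \<sigma> \<tau> s"
  shows "\<exists>\<omega>'\<in>plays G \<sigma> \<tau> s. agree n \<omega> \<omega>' \<and> fair G \<sigma> \<tau> \<omega>' \<and> \<omega>' \<in> \<Phi>"
proof (rule ccontr)
  assume none: "\<not> ?thesis"
  have "AE \<omega>' in \<PP>. \<omega>' \<in> \<Phi>" using as assms(2) by (simp add: prob_eq_1)
  then have "AE \<omega>' in \<PP>. \<omega>' \<notin> {\<omega>'. agree n \<omega> \<omega>'}"
    using AE_fair AE_plays by eventually_elim (use none in blast)
  moreover have "{\<omega>'. agree n \<omega> \<omega>'} \<in> sets \<PP>"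
  proof -
    have "(\<lambda>\<omega>'. agree n \<omega> \<omega>') \<in> \<PP> \<rightarrow>\<^sub>M count_space UNIV"
      by (rule measurable_prefix_fun[of n]) (auto simp: agree_def)
    then show ?thesis by (simp add: pred_def)
  qed
  ultimately have "{\<omega>'. agree n \<omega> \<omega>'} \<in> null_sets \<PP>"
    using AE_iff_null_sets by blast
  then have "emeasure \<PP> {\<omega>'. agree n \<omega> \<omega>'} = 0"
    by (rule null_setsD1)
  then show False using cone_positive[OF \<omega>, of n] by simp
qed

end


section \<open>Equivalence of the two semantics\<close>

text \<open>Finitely many states: eventually only recurrent ones occur, and a recurrent one of
  greatest priority keeps returning.\<close>

lemma limsup_prio:
  fixes \<omega> :: "nat \<Rightarrow> 's::finite" and prio :: "'s \<Rightarrow> nat"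
  shows "limsup (\<lambda>n. enat (prio (\<omega> n))) = enat (Max (prio ` {q. \<exists>\<^sub>\<infinity>n. \<omega> n = q}))"
proof -
  let ?I = "{q. \<exists>\<^sub>\<infinity>n. \<omega> n = q}"
  let ?M = "Max (prio ` ?I)"
  have "\<forall>\<^sub>\<infinity>n. \<forall>q\<in>- ?I. \<omega> n \<noteq> q"
    by (simp add: eventually_ball_finite not_INFM)
  then have I: "\<forall>\<^sub>\<infinity>n. \<omega> n \<in> ?I"
    by (rule MOST_mono) auto
  then obtain n where "\<omega> n \<in> ?I"
    by (auto simp: MOST_nat_le)
  then have "?M \<in> prio ` ?I" by (intro Max_in) auto
  then obtain q where q: "q \<in> ?I" "prio q = ?M" by auto
  show ?thesis
  proof (rule antisym)
    show "limsup (\<lambda>n. enat (prio (\<omega> n))) \<le> enat ?M"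
    proof (rule Limsup_bounded)
      show "\<forall>\<^sub>F n in sequentially. enat (prio (\<omega> n)) \<le> enat ?M"
        using I unfolding cofinite_eq_sequentially by (rule eventually_mono) auto
    qed
    show "enat ?M \<le> limsup (\<lambda>n. enat (prio (\<omega> n)))"
      unfolding limsup_INF_SUP
    proof (rule INF_greatest)
      fix n :: nat
      obtain m where "m \<ge> n" "\<omega> m = q" using q(1) by (auto simp: INFM_nat_le)
      then show "enat ?M \<le> (SUP m\<in>{n..}. enat (prio (\<omega> m)))"
        using q(2) by (intro SUP_upper2[of m]) auto
    qed
  qed
qed

section \<open>Encoding the stochastic game as a finite graph\<close>

context
  fixes G :: "('s::finite, 'a::finite) stochastic_game" and prio :: "'s \<Rightarrow> nat"
begin

text \<open>Each round is split into the choice of an action at \<open>Inl q\<close> and the random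
  draw at \<open>Inr (q, a)\<close>, so that only the pairs are random vertices.\<close>

definition edges :: "('s + 's \<times> 'a) rel" where
  "edges = {(Inl q, Inr (q, a)) |q a. True} \<union> {(Inr (q, a), Inl t) |q a t. t \<in> set_pmf (trans G q a)}"

text \<open>A pair inherits the priority of its state; as it recurs only if its state does, maxima
  over infinity sets are unchanged.\<close>

definition graph_prio :: "'s + 's \<times> 'a \<Rightarrow> nat" where
  "graph_prio v = (case v of Inl q \<Rightarrow> prio q | Inr (q, a) \<Rightarrow> prio q)"

interpretation fair_parity_game edges "Inl ` Eve G" "range Inr" graph_prio
  by unfold_locales auto

lemma arena_UNIV: "arena UNIV"
proof -
  have "\<exists>w. (v, w) \<in> edges" for v
  proof (cases v)
    case (Inr p)
    then show ?thesis
      using set_pmf_not_empty[of "trans G (fst p) (snd p)"] by (cases p) (auto simp: edges_def)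
  qed (auto simp: edges_def)
  then show ?thesis by (simp add: arena_def)
qed

definition graph_path :: "('s, 'a) strategy \<Rightarrow> ('s, 'a) strategy \<Rightarrow> (nat \<Rightarrow> 's) \<Rightarrow> nat \<Rightarrow> 's + 's \<times> 'a" where
  "graph_path \<sigma> \<tau> \<omega> n =
     (if even n then Inl (\<omega> (n div 2)) else Inr (\<omega> (n div 2), act G \<sigma> \<tau> \<omega> (n div 2)))"

text \<open>A vertex strategy moves from \<open>Inl q\<close> to some \<open>Inr (q, a)\<close>; the
  action is the second component there.\<close>

definition positional :: "('s + 's \<times> 'a \<Rightarrow> 's + 's \<times> 'a) \<Rightarrow> ('s, 'a) strategy" where
  "positional f h = snd (projr (f (Inl (the_state (last h)))))"

lemma last_hist: "last (hist G \<sigma> \<tau> \<omega> n) = State (\<omega> n)"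
  by (cases n) auto

lemma act_positional:
  "\<omega> n \<in> Eve G \<Longrightarrow> act G (positional f) \<tau> \<omega> n = snd (projr (f (Inl (\<omega> n))))"
  "\<omega> n \<notin> Eve G \<Longrightarrow> act G \<sigma> (positional f) \<omega> n = snd (projr (f (Inl (\<omega> n))))"
  by (simp_all add: act_def choice_def positional_def last_hist)

lemma edges_Inl: "(Inl q, w) \<in> edges \<Longrightarrow> w = Inr (q, snd (projr w))"
  by (auto simp: edges_def)

lemma graph_path_edge:
  assumes "\<omega> \<in> plays G \<sigma> \<tau> s"
  shows "(graph_path \<sigma> \<tau> \<omega> n, graph_path \<sigma> \<tau> \<omega> (Suc n)) \<in> edges"
proof (cases "even n")
  case True
  then show ?thesis by (auto simp: graph_path_def edges_def elim!: evenE)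
next
  case False
  then obtain k where n: "n = 2 * k + 1" by (auto elim: oddE)
  have "\<omega> (Suc k) \<in> set_pmf (trans G (\<omega> k) (act G \<sigma> \<tau> \<omega> k))"
    using assms by (simp add: plays_def succs_def)
  then show ?thesis by (simp add: n graph_path_def edges_def)
qed

lemma INFM_parity:
  "(\<exists>\<^sub>\<infinity>n::nat. even n \<and> P (n div 2)) \<longleftrightarrow> (\<exists>\<^sub>\<infinity>n. P n)"
  "(\<exists>\<^sub>\<infinity>n::nat. odd n \<and> P (n div 2)) \<longleftrightarrow> (\<exists>\<^sub>\<infinity>n. P n)"
proof -
  have ev: "\<exists>k\<ge>m. P k" if "\<And>m. \<exists>n\<ge>m. P (n div 2)" for m
  proof -
    obtain n where "n \<ge> 2 * m" "P (n div 2)" using \<open>\<And>m. \<exists>n\<ge>m. P (n div 2)\<close> by blast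
    then show ?thesis by (intro exI[of _ "n div 2"]) auto
  qed
  show "(\<exists>\<^sub>\<infinity>n::nat. even n \<and> P (n div 2)) \<longleftrightarrow> (\<exists>\<^sub>\<infinity>n. P n)"
    unfolding INFM_nat_le
  proof (intro iffI allI)
    fix m assume "\<forall>m. \<exists>n\<ge>m. even n \<and> P (n div 2)"
    then show "\<exists>n\<ge>m. P n" by (intro ev) blast
  next
    fix m assume "\<forall>m. \<exists>n\<ge>m. P n"
    then obtain n where "n \<ge> m" "P n" by blast
    then show "\<exists>n\<ge>m. even n \<and> P (n div 2)" by (intro exI[of _ "2 * n"]) auto
  qed
  show "(\<exists>\<^sub>\<infinity>n::nat. odd n \<and> P (n div 2)) \<longleftrightarrow> (\<exists>\<^sub>\<infinity>n. P n)"
    unfolding INFM_nat_le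
  proof (intro iffI allI)
    fix m assume "\<forall>m. \<exists>n\<ge>m. odd n \<and> P (n div 2)"
    then show "\<exists>n\<ge>m. P n" by (intro ev) blast
  next
    fix m assume "\<forall>m. \<exists>n\<ge>m. P n"
    then obtain n where "n \<ge> m" "P n" by blast
    then show "\<exists>n\<ge>m. odd n \<and> P (n div 2)" by (intro exI[of _ "2 * n + 1"]) auto
  qed
qed

lemma infs_graph_path:
  "Inl q \<in> infs (graph_path \<sigma> \<tau> \<omega>) \<longleftrightarrow> (\<exists>\<^sub>\<infinity>n. \<omega> n = q)"
  "Inr (q, a) \<in> infs (graph_path \<sigma> \<tau> \<omega>) \<longleftrightarrow> (\<exists>\<^sub>\<infinity>n. visits G \<sigma> \<tau> \<omega> n q a)"
proof -
  have "graph_path \<sigma> \<tau> \<omega> n = Inl q \<longleftrightarrow> even n \<and> \<omega> (n div 2) = q" for n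
    by (simp add: graph_path_def)
  then show "Inl q \<in> infs (graph_path \<sigma> \<tau> \<omega>) \<longleftrightarrow> (\<exists>\<^sub>\<infinity>n. \<omega> n = q)"
    using INFM_parity(1)[of "\<lambda>n. \<omega> n = q"] by (simp add: infs_def)
  have "graph_path \<sigma> \<tau> \<omega> n = Inr (q, a) \<longleftrightarrow> odd n \<and> visits G \<sigma> \<tau> \<omega> (n div 2) q a" for n
    by (auto simp: graph_path_def visits_def)
  then show "Inr (q, a) \<in> infs (graph_path \<sigma> \<tau> \<omega>) \<longleftrightarrow> (\<exists>\<^sub>\<infinity>n. visits G \<sigma> \<tau> \<omega> n q a)"
    using INFM_parity(2)[of "\<lambda>n. visits G \<sigma> \<tau> \<omega> n q a"] by (simp add: infs_def)
qed

lemma graph_path_fair: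
  assumes "fair G \<sigma> \<tau> \<omega>" "v \<in> infs (graph_path \<sigma> \<tau> \<omega>)" "v \<in> range Inr" "(v, w) \<in> edges"
  shows "w \<in> infs (graph_path \<sigma> \<tau> \<omega>)"
proof -
  obtain q a t where vw: "v = Inr (q, a)" "w = Inl t" "t \<in> set_pmf (trans G q a)"
    using assms(3,4) by (auto simp: edges_def)
  then have "\<exists>\<^sub>\<infinity>n. visits G \<sigma> \<tau> \<omega> n q a"
    using assms(2) by (simp add: infs_graph_path)
  then have "\<exists>\<^sub>\<infinity>n. visits G \<sigma> \<tau> \<omega> n q a \<and> \<omega> (Suc n) = t"
    using assms(1) vw(3) by (simp add: fair_def)
  then have "\<exists>\<^sub>\<infinity>n. \<omega> (Suc n) = t"
    by (rule INFM_mono) auto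
  then have "\<exists>\<^sub>\<infinity>n. \<omega> n = t"
    unfolding INFM_nat_le by (metis le_SucI)
  then show ?thesis by (simp add: vw(2) infs_graph_path)
qed

lemma graph_prio_infs:
  "Max (graph_prio ` infs (graph_path \<sigma> \<tau> \<omega>)) = Max (prio ` {q. \<exists>\<^sub>\<infinity>n. \<omega> n = q})"
proof -
  have "\<exists>\<^sub>\<infinity>n. \<omega> n = q" if "Inr (q, a) \<in> infs (graph_path \<sigma> \<tau> \<omega>)" for q a
    using that unfolding infs_graph_path by (rule INFM_mono) (simp add: visits_def)
  then have "graph_prio ` infs (graph_path \<sigma> \<tau> \<omega>) = prio ` {q. \<exists>\<^sub>\<infinity>n. \<omega> n = q}"
    by (force simp: graph_prio_def infs_graph_path image_iff split: sum.split)
  then show ?thesis by simp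
qed

lemma parity_objective_graph_path:
  "\<omega> \<in> parity_objective prio \<longleftrightarrow> even_max (infs (graph_path \<sigma> \<tau> \<omega>))"
  by (simp add: parity_objective_def limsup_prio graph_prio_infs)

text \<open>Index \<open>2 * n + 1\<close> holds the pair of the \<open>n\<close>-th state and its
  action, which is determined by the states up to \<open>n\<close>.\<close>

lemma agree_graph_path:
  assumes "agree n \<omega> \<omega>'" "i \<le> 2 * n + 1"
  shows "graph_path \<sigma> \<tau> \<omega>' i = graph_path \<sigma> \<tau> \<omega> i"
proof -
  have i: "i div 2 \<le> n" using assms(2) by simp
  have "\<omega> (i div 2) = \<omega>' (i div 2)" using agree_nth[OF assms(1) i] .
  moreover have "act G \<sigma> \<tau> \<omega> (i div 2) = act G \<sigma> \<tau> \<omega>' (i div 2)"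
    by (rule act_agree[OF agree_mono[OF assms(1) i]])
  ultimately show ?thesis by (simp add: graph_path_def)
qed

text \<open>\<open>s\<close> lies in one of the two certified regions of the full graph. The owner
  of that region plays the certificate positionally, and the certificate handles arbitrary
  strategies of the opponent.\<close>

lemma qualitative_determinacy:
  "(\<exists>\<sigma>. \<forall>\<tau>. \<forall>\<omega>\<in>plays G \<sigma> \<tau> s. fair G \<sigma> \<tau> \<omega> \<longrightarrow> \<omega> \<in> parity_objective prio) \<or>
   (\<exists>\<tau>. \<forall>\<sigma>. \<exists>\<omega>\<in>plays G \<sigma> \<tau> s. \<exists>n. \<forall>\<omega>'\<in>plays G \<sigma> \<tau> s. agree n \<omega> \<omega>' \<longrightarrow>
      fair G \<sigma> \<tau> \<omega>' \<longrightarrow> \<omega>' \<notin> parity_objective prio)"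
proof -
  obtain W L f g where WL: "W \<union> L = UNIV" and W: "eve_cert UNIV W f" and L: "adam_cert UNIV L g"
    using arena_solved[OF arena_UNIV] by blast
  show ?thesis
  proof (cases "Inl s \<in> W")
    case True
    have "\<omega> \<in> parity_objective prio"
      if \<omega>: "\<omega> \<in> plays G (positional f) \<tau> s" and fair: "fair G (positional f) \<tau> \<omega>" for \<tau> \<omega>
    proof -
      let ?p = "graph_path (positional f) \<tau> \<omega>"
      have W_eve: "(v, f v) \<in> edges" "f v \<in> W" if "v \<in> W" "v \<in> Inl ` Eve G" for v
        using W that by (auto simp: eve_cert_def)
      have W_other: "w \<in> W" if "v \<in> W" "v \<notin> Inl ` Eve G" "(v, w) \<in> edges" for v w
      proof -
        have "edges `` {v} \<subseteq> W" using W that(1,2) by (simp add: eve_cert_def)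
        then show ?thesis using that(3) by auto
      qed
      have move: "?p (Suc n) = f (?p n)" if pn: "?p n \<in> W" "?p n \<in> Inl ` Eve G" for n
      proof -
        from pn(2) have n: "even n" "\<omega> (n div 2) \<in> Eve G" "?p n = Inl (\<omega> (n div 2))"
          by (auto simp: graph_path_def split: if_splits)
        \<comment> \<open>Edges from \<open>Inl q\<close> lead only to pairs with first component
          \<open>q\<close>, so the chosen action determines the vertex.\<close>
        have "f (?p n) = Inr (\<omega> (n div 2), snd (projr (f (?p n))))"
          using edges_Inl W_eve(1)[OF pn] n(3) by simp
        then show ?thesis
          using n by (auto simp: graph_path_def act_positional)
      qed
      have in_W: "?p n \<in> W" for n
      proof (induction n)
        case 0
        then show ?case using True \<omega> by (simp add: graph_path_def plays_def)
      next
        case (Suc n)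
        then show ?case
          using W_eve(2)[of "?p n"] W_other[of "?p n"] move[of n] graph_path_edge[OF \<omega>, of n]
          by (cases "?p n \<in> Inl ` Eve G") auto
      qed
      have "even_max (infs ?p)"
      proof (rule eve_cert_path[OF W in_W])
        show "(?p n, ?p (Suc n)) \<in> consistent (Inl ` Eve G) f" for n
          using graph_path_edge[OF \<omega>, of n] move[OF in_W, of n] by (auto simp: consistent_def)
      qed (rule graph_path_fair[OF fair])
      then show ?thesis by (rule parity_objective_graph_path[THEN iffD2])
    qed
    then show ?thesis by blast
  next
    case False
    then have s: "Inl s \<in> L" using WL by auto
    have "\<exists>\<omega>\<in>plays G \<sigma> (positional g) s. \<exists>n. \<forall>\<omega>'\<in>plays G \<sigma> (positional g) s. agree n \<omega> \<omega>' \<longrightarrow>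
      fair G \<sigma> (positional g) \<omega>' \<longrightarrow> \<omega>' \<notin> parity_objective prio" for \<sigma>
    proof -
      let ?path = "graph_path \<sigma> (positional g)" and ?plays = "plays G \<sigma> (positional g) s"
      \<comment> \<open>The paths of all plays against the arbitrary strategy
        \<open>\<sigma>\<close> form the family to which Adam's certificate is applied.\<close>
      have "\<exists>p\<in>?path ` ?plays. \<exists>n. \<forall>q\<in>?path ` ?plays. (\<forall>i\<le>n. q i = p i) \<longrightarrow>
        (\<forall>v w. v \<in> infs q \<longrightarrow> v \<in> range Inr \<longrightarrow> (v, w) \<in> edges \<longrightarrow> w \<in> infs q) \<longrightarrow> \<not> even_max (infs q)"
      proof (rule adam_cert_paths[OF L])
        show "?path ` ?plays \<noteq> {}" using plays_nonempty by blast
        show "p 0 \<in> L" if "p \<in> ?path ` ?plays" for p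
          using that s by (auto simp: graph_path_def plays_def)
      next
        fix p n assume "p \<in> ?path ` ?plays" and pL: "p n \<in> L"
        then obtain \<omega> where \<omega>: "\<omega> \<in> ?plays" "p = ?path \<omega>" by blast
        have "p (Suc n) = g (p n)" if "p n \<in> VA"
        proof -
          from that have n: "even n" "\<omega> (n div 2) \<notin> Eve G" "p n = Inl (\<omega> (n div 2))"
            by (auto simp: graph_path_def \<omega>(2) split: if_splits)
          have "(p n, g (p n)) \<in> edges" using L pL that by (simp add: adam_cert_def)
          then have "g (p n) = Inr (\<omega> (n div 2), snd (projr (g (p n))))"
            unfolding n(3) by (rule edges_Inl)
          then show ?thesis
            using n by (auto simp: \<omega>(2) graph_path_def act_positional)
        qed
        then show "(p n, p (Suc n)) \<in> consistent VA g"
          using graph_path_edge[OF \<omega>(1), of n] by (simp add: \<omega>(2) consistent_def)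
      next
        fix p n w assume "p \<in> ?path ` ?plays" and pn: "p n \<in> range Inr" "(p n, w) \<in> edges"
        then obtain \<omega> where \<omega>: "\<omega> \<in> ?plays" "p = ?path \<omega>" by blast
        obtain k where k: "n = 2 * k + 1"
          using pn(1) by (auto simp: graph_path_def \<omega>(2) split: if_splits elim: oddE)
        obtain t where t: "w = Inl t" "t \<in> succs G \<sigma> (positional g) \<omega> k"
          using pn(2) by (auto simp: graph_path_def \<omega>(2) k edges_def succs_def)
        obtain \<omega>' where \<omega>': "\<omega>' \<in> ?plays" "agree k \<omega> \<omega>'" "\<omega>' (Suc k) = t"
          using plays_extend[OF \<omega>(1) t(2)] by blast
        have "?path \<omega>' i = p i" if "i \<le> n" for i
          using agree_graph_path[OF \<omega>'(2)] that by (simp add: k \<omega>(2))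
        moreover have "?path \<omega>' (Suc n) = w"
          by (simp add: k graph_path_def t(1) \<omega>'(3))
        ultimately show "\<exists>q\<in>?path ` ?plays. (\<forall>i\<le>n. q i = p i) \<and> q (Suc n) = w"
          using \<omega>'(1) by blast
      qed
      then obtain \<omega> n where \<omega>: "\<omega> \<in> ?plays" and bad: "\<And>\<omega>'. \<omega>' \<in> ?plays \<Longrightarrow>
        \<forall>i\<le>n. ?path \<omega>' i = ?path \<omega> i \<Longrightarrow> \<forall>v w. v \<in> infs (?path \<omega>') \<longrightarrow> v \<in> range Inr \<longrightarrow>
          (v, w) \<in> edges \<longrightarrow> w \<in> infs (?path \<omega>') \<Longrightarrow> \<not> even_max (infs (?path \<omega>'))"
        by blast
      have "\<omega>' \<notin> parity_objective prio"
        if "\<omega>' \<in> ?plays" "agree n \<omega> \<omega>'" "fair G \<sigma> (positional g) \<omega>'" for \<omega>'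
      proof -
        \<comment> \<open>Agreement of states up to \<open>n\<close> fixes the graph path up to
          \<open>2 * n + 1\<close>, in particular up to \<open>n\<close>.\<close>
        have "\<not> even_max (infs (?path \<omega>'))"
          using agree_graph_path[OF that(2)] graph_path_fair[OF that(3)]
          by (intro bad[OF that(1)]) auto
        then show ?thesis using parity_objective_graph_path by blast
      qed
      then show ?thesis using \<omega> by blast
    qed
    then show ?thesis by blast
  qed
qed

end

theorem theorem14:
  fixes G :: "('s::finite, 'a::finite) stochastic_game"
    and prio :: "'s \<Rightarrow> nat"
    and s :: 's
  assumes "is_stochastic_game G"
  shows "wins_almost_surely G (parity_objective prio) s \<longleftrightarrow>
         wins_strategically (induced_bm_game G) (parity_objective prio) s"
proof -
  let ?\<Phi> = "parity_objective prio"
  \<comment> \<open>Each alternative settles both semantics alike: fairness suffices in the first,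
    and in the second a prefix without a fair winning extension contradicts either kind of
    win.\<close>
  consider
    (eve) \<sigma> where "\<And>\<tau> \<omega>. \<omega> \<in> plays G \<sigma> \<tau> s \<Longrightarrow> fair G \<sigma> \<tau> \<omega> \<Longrightarrow> \<omega> \<in> ?\<Phi>"
  | (adam) \<tau> where "\<And>\<sigma>. \<exists>\<omega>\<in>plays G \<sigma> \<tau> s. \<exists>n. \<forall>\<omega>'\<in>plays G \<sigma> \<tau> s. agree n \<omega> \<omega>' \<longrightarrow>
      fair G \<sigma> \<tau> \<omega>' \<longrightarrow> \<omega>' \<notin> ?\<Phi>"
    using qualitative_determinacy[of G s prio] by blast
  then show ?thesis
  proof cases
    case eve
    have "measure (play_measure G \<sigma> \<tau> s) ?\<Phi> = 1" for \<tau>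
      by (rule almost_sure_if_fair[OF eve parity_objective_measurable])
    moreover have "banach_wins (residual_tree (induced_bm_game G) \<sigma> \<tau> s) {x. state_seq x \<in> ?\<Phi>}" for \<tau>
      by (rule banach_wins_if_fair[OF eve])
    ultimately show ?thesis
      unfolding wins_almost_surely_def wins_strategically_def by blast
  next
    case adam
    have "measure (play_measure G \<sigma> \<tau> s) ?\<Phi> \<noteq> 1" for \<sigma>
      using adam[of \<sigma>] fair_if_almost_sure[OF _ parity_objective_measurable] by blast
    moreover have "\<not> banach_wins (residual_tree (induced_bm_game G) \<sigma> \<tau> s) {x. state_seq x \<in> ?\<Phi>}" for \<sigma>
      using adam[of \<sigma>] fair_if_banach_wins by blast
    ultimately show ?thesis
      unfolding wins_almost_surely_def wins_strategically_def by blast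
  qed
qed

end
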